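(* Let $\mathcal{A}:\mathbf{Causet}\to\mathbf{C^*Alg}$ be a $\mathrm{C}^*$-causal functor and let $K$ be a causal poset. For $o\in K$ let $(K|o):=\{a\in K : a\le o\}$ (with the order and causal disjointness relation inherited from $K$; it is a causal poset), let $\iota_o:(K|o)\to K$ be the inclusion morphism, and set $\mathcal{A}_o:=\mathcal{A}_{\iota_o}(\mathcal{A}(K|o))$. Then: (i) each $\mathcal{A}_o$ is a $\mathrm{C}^*$-subalgebra of $\mathcal{A}(K)$, $\mathcal{A}_o\subseteq\mathcal{A}_a$ whenever $o\le a$, and $(\mathcal{A},\mathrm{id})_K$ (the assignment $o\mapsto\mathcal{A}_o$ with the set-theoretic inclusions $\mathrm{id}_{ao}:\mathcal{A}_o\to\mathcal{A}_a$ as inclusion maps) is a causal net of $\mathrm{C}^*$-subalgebras of $\mathcal{A}(K)$; (ii) if $S$ is a symmetry group of $K$ and $\alpha_s:=\mathcal{A}_s$ for $s\in S$, then each $\alpha_s$ is a $^*$-automorphism of $\mathcal{A}(K)$ restricting to $^*$-isomorphisms $\mathcal{A}_o\to\mathcal{A}_{s(o)}$, and the net $(\mathcal{A},\mathrm{id},\alpha)_K$ is $S$-covariant.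
   Context: A poset $K$ (nonempty set with a partial order $\le$) is pathwise connected if for all $a,a'\in K$ there are $a_1=a,a_2,\dots,a_{n+1}=a'$ and $o_1,\dots,o_n$ in $K$ with $a_i,a_{i+1}\le o_i$ for all $i$. A causal disjointness relation on $K$ is an irreflexive symmetric binary relation $\perp$ such that $o\perp a$ and $\tilde o\le o$ imply $\tilde o\perp a$. A causal poset is a pathwise connected poset with a causal disjointness relation. A morphism $\psi:K\to K'$ of causal posets is an injective map with $a\le\tilde a\Rightarrow\psi(a)\le'\psi(\tilde a)$ and $o\perp\tilde o\Leftrightarrow\psi(o)\perp'\psi(\tilde o)$; $(K,K')$ denotes the set of morphisms, and $\mathbf{Causet}$ is the resulting category. A symmetry group of $K$ is a subgroup $S$ of the group of automorphisms of $K$ in $\mathbf{Causet}$. $\mathbf{C^*Alg}$ is the category of unital $\mathrm{C}^*$-algebras with unital injective $^*$-homomorphisms as arrows. A $\mathrm{C}^*$-causal functor is a functor $\mathcal{A}:\mathbf{Causet}\to\mathbf{C^*Alg}$ (written $K\mapsto\mathcal{A}(K)$, $\psi\mapsto\mathcal{A}_\psi$) such that whenever $\psi_i\in(K_i,K)$, $i=1,2$, and there are $o_1\perp o_2$ in $K$ with $\psi_i(a)\le o_i$ for all $a\in K_i$, then $\mathcal{A}_{\psi_1}(A)\mathcal{A}_{\psi_2}(B)=\mathcal{A}_{\psi_2}(B)\mathcal{A}_{\psi_1}(A)$ for all $A\in\mathcal{A}(K_1)$, $B\in\mathcal{A}(K_2)$. A net of $\mathrm{C}^*$-algebras over $K$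 is an assignment of unital $\mathrm{C}^*$-algebras $\mathcal{A}_o$, $o\in K$, and unital injective $^*$-homomorphisms $\jmath_{ao}:\mathcal{A}_o\to\mathcal{A}_a$ for $o\le a$ with $\jmath_{o''o'}\circ\jmath_{o'o}=\jmath_{o''o}$ for $o\le o'\le o''$. It is causal if $[\jmath_{ao_1}(\mathcal{A}_{o_1}),\jmath_{ao_2}(\mathcal{A}_{o_2})]=0$ whenever $o_1,o_2\le a$ and $o_1\perp o_2$. For a symmetry group $S$ of $K$ it is $S$-covariant if there are $^*$-isomorphisms $\alpha^o_g:\mathcal{A}_o\to\mathcal{A}_{g(o)}$, $o\in K$, $g\in S$, with $\alpha^{h(o)}_g\circ\alpha^o_h=\alpha^o_{gh}$ and $\alpha^a_g\circ\jmath_{ao}=\jmath_{g(a)g(o)}\circ\alpha^o_g$ for $o\le a$, $g,h\in S$ (here $\alpha^o_s$ is the restriction of $\alpha_s$ to $\mathcal{A}_o$). *)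

theory Defs
  imports Complex_Main "HOL-Library.FuncSet"
begin

text \<open>A causal poset with points of type 'a: carrier, order, causal disjointness.
  The relations are required to live on the carrier.\<close>

record 'a causet =
  cs_carrier :: "'a set"
  cs_le :: "'a \<Rightarrow> 'a \<Rightarrow> bool"
  cs_perp :: "'a \<Rightarrow> 'a \<Rightarrow> bool"

definition poset :: "'a causet \<Rightarrow> bool" where
  "poset K \<longleftrightarrow> cs_carrier K \<noteq> {}
     \<and> (\<forall>x y. cs_le K x y \<longrightarrow> x \<in> cs_carrier K \<and> y \<in> cs_carrier K)
     \<and> (\<forall>x\<in>cs_carrier K. cs_le K x x)
     \<and> (\<forall>x y. cs_le K x y \<and> cs_le K y x \<longrightarrow> x = y)
     \<and> (\<forall>x y z. cs_le K x y \<and> cs_le K y z \<longrightarrow> cs_le K x z)"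

definition pathwise_connected :: "'a causet \<Rightarrow> bool" where
  "pathwise_connected K \<longleftrightarrow>
     (\<forall>a\<in>cs_carrier K. \<forall>a'\<in>cs_carrier K. \<exists>n::nat. \<exists>as os.
        (\<forall>i\<le>n. as i \<in> cs_carrier K) \<and> (\<forall>i<n. os i \<in> cs_carrier K) \<and>
        as 0 = a \<and> as n = a' \<and>
        (\<forall>i<n. cs_le K (as i) (os i) \<and> cs_le K (as (Suc i)) (os i)))"

definition causal_disjointness :: "'a causet \<Rightarrow> bool" where
  "causal_disjointness K \<longleftrightarrow>
     (\<forall>x y. cs_perp K x y \<longrightarrow> x \<in> cs_carrier K \<and> y \<in> cs_carrier K)
     \<and> (\<forall>x. \<not> cs_perp K x x)
     \<and> (\<forall>x y. cs_perp K x y \<longrightarrow> cs_perp K y x)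
     \<and> (\<forall>p a p'. cs_perp K p a \<and> cs_le K p' p \<longrightarrow> cs_perp K p' a)"

definition causal_poset :: "'a causet \<Rightarrow> bool" where
  "causal_poset K \<longleftrightarrow> poset K \<and> pathwise_connected K \<and> causal_disjointness K"

definition cmor :: "'a causet \<Rightarrow> 'a causet \<Rightarrow> ('a \<Rightarrow> 'a) set" where
  "cmor K K' = {\<psi>. \<psi> \<in> extensional (cs_carrier K)
      \<and> \<psi> ` cs_carrier K \<subseteq> cs_carrier K'
      \<and> inj_on \<psi> (cs_carrier K)
      \<and> (\<forall>a\<in>cs_carrier K. \<forall>b\<in>cs_carrier K. cs_le K a b \<longrightarrow> cs_le K' (\<psi> a) (\<psi> b))
      \<and> (\<forall>a\<in>cs_carrier K. \<forall>b\<in>cs_carrier K. cs_perp K a b \<longleftrightarrow> cs_perp K' (\<psi> a) (\<psi> b))}"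

definition cid :: "'a causet \<Rightarrow> 'a \<Rightarrow> 'a" where
  "cid K = restrict id (cs_carrier K)"

definition automorphisms :: "'a causet \<Rightarrow> ('a \<Rightarrow> 'a) set" where
  "automorphisms K = {\<psi> \<in> cmor K K. \<exists>\<phi>\<in>cmor K K.
      compose (cs_carrier K) \<psi> \<phi> = cid K \<and> compose (cs_carrier K) \<phi> \<psi> = cid K}"

definition symmetry_group :: "'a causet \<Rightarrow> ('a \<Rightarrow> 'a) set \<Rightarrow> bool" where
  "symmetry_group K S \<longleftrightarrow> S \<subseteq> automorphisms K \<and> cid K \<in> S
     \<and> (\<forall>g\<in>S. \<forall>h\<in>S. compose (cs_carrier K) g h \<in> S)
     \<and> (\<forall>g\<in>S. \<exists>h\<in>S. compose (cs_carrier K) g h = cid K \<and> compose (cs_carrier K) h g = cid K)"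

definition below :: "'a causet \<Rightarrow> 'a \<Rightarrow> 'a causet" where
  "below K p = (let S = {a \<in> cs_carrier K. cs_le K a p} in
     \<lparr>cs_carrier = S,
      cs_le = (\<lambda>x y. x \<in> S \<and> y \<in> S \<and> cs_le K x y),
      cs_perp = (\<lambda>x y. x \<in> S \<and> y \<in> S \<and> cs_perp K x y)\<rparr>)"

definition incl :: "'a causet \<Rightarrow> 'a \<Rightarrow> 'a \<Rightarrow> 'a" where
  "incl K p = restrict id (cs_carrier (below K p))"

record 'b cstar =
  carrier :: "'b set"
  zero :: 'b
  one :: 'b
  add :: "'b \<Rightarrow> 'b \<Rightarrow> 'b"
  smult :: "complex \<Rightarrow> 'b \<Rightarrow> 'b"
  mult :: "'b \<Rightarrow> 'b \<Rightarrow> 'b"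
  star :: "'b \<Rightarrow> 'b"
  cnorm :: "'b \<Rightarrow> real"

definition cdist :: "'b cstar \<Rightarrow> 'b \<Rightarrow> 'b \<Rightarrow> real" where
  "cdist C x y = cnorm C (add C x (smult C (-1) y))"

definition cstar_alg :: "'b cstar \<Rightarrow> bool" where
  "cstar_alg C \<longleftrightarrow> (let X = carrier C in
     zero C \<in> X \<and> one C \<in> X
     \<and> (\<forall>x\<in>X. \<forall>y\<in>X. add C x y \<in> X \<and> mult C x y \<in> X)
     \<and> (\<forall>a. \<forall>x\<in>X. smult C a x \<in> X) \<and> (\<forall>x\<in>X. star C x \<in> X)
     \<comment> \<open>complex vector space\<close>
     \<and> (\<forall>x\<in>X. \<forall>y\<in>X. \<forall>z\<in>X. add C (add C x y) z = add C x (add C y z))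
     \<and> (\<forall>x\<in>X. \<forall>y\<in>X. add C x y = add C y x)
     \<and> (\<forall>x\<in>X. add C x (zero C) = x)
     \<and> (\<forall>x\<in>X. add C x (smult C (-1) x) = zero C)
     \<and> (\<forall>a. \<forall>x\<in>X. \<forall>y\<in>X. smult C a (add C x y) = add C (smult C a x) (smult C a y))
     \<and> (\<forall>a b. \<forall>x\<in>X. smult C (a + b) x = add C (smult C a x) (smult C b x))
     \<and> (\<forall>a b. \<forall>x\<in>X. smult C a (smult C b x) = smult C (a * b) x)
     \<and> (\<forall>x\<in>X. smult C 1 x = x)
     \<comment> \<open>unital associative algebra\<close>
     \<and> (\<forall>x\<in>X. \<forall>y\<in>X. \<forall>z\<in>X. mult C (mult C x y) z = mult C x (mult C y z))
     \<and> (\<forall>x\<in>X. \<forall>y\<in>X. \<forall>z\<in>X. mult C x (add C y z) = add C (mult C x y) (mult C x z))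
     \<and> (\<forall>x\<in>X. \<forall>y\<in>X. \<forall>z\<in>X. mult C (add C x y) z = add C (mult C x z) (mult C y z))
     \<and> (\<forall>a. \<forall>x\<in>X. \<forall>y\<in>X. mult C (smult C a x) y = smult C a (mult C x y)
                          \<and> mult C x (smult C a y) = smult C a (mult C x y))
     \<and> (\<forall>x\<in>X. mult C (one C) x = x \<and> mult C x (one C) = x)
     \<comment> \<open>involution\<close>
     \<and> (\<forall>x\<in>X. \<forall>y\<in>X. star C (add C x y) = add C (star C x) (star C y))
     \<and> (\<forall>a. \<forall>x\<in>X. star C (smult C a x) = smult C (cnj a) (star C x))
     \<and> (\<forall>x\<in>X. \<forall>y\<in>X. star C (mult C x y) = mult C (star C y) (star C x))
     \<and> (\<forall>x\<in>X. star C (star C x) = x)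
     \<comment> \<open>norm, submultiplicativity, C*-identity\<close>
     \<and> (\<forall>x\<in>X. cnorm C x \<ge> 0 \<and> (cnorm C x = 0 \<longleftrightarrow> x = zero C))
     \<and> (\<forall>a. \<forall>x\<in>X. cnorm C (smult C a x) = cmod a * cnorm C x)
     \<and> (\<forall>x\<in>X. \<forall>y\<in>X. cnorm C (add C x y) \<le> cnorm C x + cnorm C y)
     \<and> (\<forall>x\<in>X. \<forall>y\<in>X. cnorm C (mult C x y) \<le> cnorm C x * cnorm C y)
     \<and> (\<forall>x\<in>X. cnorm C (mult C (star C x) x) = (cnorm C x)\<^sup>2)
     \<comment> \<open>completeness\<close>
     \<and> (\<forall>f. (\<forall>n. f n \<in> X) \<and> (\<forall>e>0. \<exists>N::nat. \<forall>m\<ge>N. \<forall>n\<ge>N. cdist C (f m) (f n) < e)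
            \<longrightarrow> (\<exists>x\<in>X. \<forall>e>0. \<exists>N::nat. \<forall>n\<ge>N. cdist C (f n) x < e)))"

definition cstar_subalg :: "'b cstar \<Rightarrow> 'b set \<Rightarrow> bool" where
  "cstar_subalg C Y \<longleftrightarrow> Y \<subseteq> carrier C \<and> one C \<in> Y
     \<and> (\<forall>x\<in>Y. \<forall>y\<in>Y. add C x y \<in> Y \<and> mult C x y \<in> Y)
     \<and> (\<forall>a. \<forall>x\<in>Y. smult C a x \<in> Y) \<and> (\<forall>x\<in>Y. star C x \<in> Y)
     \<and> (\<forall>f x. (\<forall>n. f n \<in> Y) \<and> x \<in> carrier C \<and> (\<forall>e>0. \<exists>N::nat. \<forall>n\<ge>N. cdist C (f n) x < e)
            \<longrightarrow> x \<in> Y)"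

definition sub_cstar :: "'b cstar \<Rightarrow> 'b set \<Rightarrow> 'b cstar" where
  "sub_cstar C Y = C\<lparr>carrier := Y\<rparr>"

definition star_hom :: "'b cstar \<Rightarrow> 'b cstar \<Rightarrow> ('b \<Rightarrow> 'b) \<Rightarrow> bool" where
  "star_hom C D f \<longleftrightarrow> f ` carrier C \<subseteq> carrier D
     \<and> (\<forall>x\<in>carrier C. \<forall>y\<in>carrier C. f (add C x y) = add D (f x) (f y)
                                     \<and> f (mult C x y) = mult D (f x) (f y))
     \<and> (\<forall>a. \<forall>x\<in>carrier C. f (smult C a x) = smult D a (f x))
     \<and> (\<forall>x\<in>carrier C. f (star C x) = star D (f x))
     \<and> f (one C) = one D"

definition cstar_arrow :: "'b cstar \<Rightarrow> 'b cstar \<Rightarrow> ('b \<Rightarrow> 'b) \<Rightarrow> bool" where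
  "cstar_arrow C D f \<longleftrightarrow> star_hom C D f \<and> inj_on f (carrier C)"

definition star_iso :: "'b cstar \<Rightarrow> 'b cstar \<Rightarrow> ('b \<Rightarrow> 'b) \<Rightarrow> bool" where
  "star_iso C D f \<longleftrightarrow> star_hom C D f \<and> bij_betw f (carrier C) (carrier D)"

definition star_automorphism :: "'b cstar \<Rightarrow> ('b \<Rightarrow> 'b) \<Rightarrow> bool" where
  "star_automorphism C f \<longleftrightarrow> star_iso C C f"

definition cstar_causal_functor ::
  "('a causet \<Rightarrow> 'b cstar) \<Rightarrow> ('a causet \<Rightarrow> 'a causet \<Rightarrow> ('a \<Rightarrow> 'a) \<Rightarrow> 'b \<Rightarrow> 'b) \<Rightarrow> bool" where
  "cstar_causal_functor Aobj Amor \<longleftrightarrow>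
     (\<forall>K. causal_poset K \<longrightarrow> cstar_alg (Aobj K))
   \<and> (\<forall>K K' \<psi>. causal_poset K \<and> causal_poset K' \<and> \<psi> \<in> cmor K K'
        \<longrightarrow> cstar_arrow (Aobj K) (Aobj K') (Amor K K' \<psi>))
   \<and> (\<forall>K. causal_poset K \<longrightarrow> (\<forall>x\<in>carrier (Aobj K). Amor K K (cid K) x = x))
   \<and> (\<forall>K1 K2 K3 \<psi> \<phi>. causal_poset K1 \<and> causal_poset K2 \<and> causal_poset K3
        \<and> \<psi> \<in> cmor K1 K2 \<and> \<phi> \<in> cmor K2 K3 \<longrightarrow>
        (\<forall>x\<in>carrier (Aobj K1).
           Amor K1 K3 (compose (cs_carrier K1) \<phi> \<psi>) x = Amor K2 K3 \<phi> (Amor K1 K2 \<psi> x)))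
   \<and> (\<forall>K1 K2 K \<psi>1 \<psi>2 o1 o2. causal_poset K1 \<and> causal_poset K2 \<and> causal_poset K
        \<and> \<psi>1 \<in> cmor K1 K \<and> \<psi>2 \<in> cmor K2 K
        \<and> o1 \<in> cs_carrier K \<and> o2 \<in> cs_carrier K \<and> cs_perp K o1 o2
        \<and> (\<forall>a\<in>cs_carrier K1. cs_le K (\<psi>1 a) o1)
        \<and> (\<forall>a\<in>cs_carrier K2. cs_le K (\<psi>2 a) o2) \<longrightarrow>
        (\<forall>A\<in>carrier (Aobj K1). \<forall>B\<in>carrier (Aobj K2).
           mult (Aobj K) (Amor K1 K \<psi>1 A) (Amor K2 K \<psi>2 B)
         = mult (Aobj K) (Amor K2 K \<psi>2 B) (Amor K1 K \<psi>1 A)))"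

definition cnet :: "'a causet \<Rightarrow> ('a \<Rightarrow> 'b cstar) \<Rightarrow> ('a \<Rightarrow> 'a \<Rightarrow> 'b \<Rightarrow> 'b) \<Rightarrow> bool" where
  "cnet K Aof j \<longleftrightarrow>
     (\<forall>p\<in>cs_carrier K. cstar_alg (Aof p))
   \<and> (\<forall>p a. cs_le K p a \<longrightarrow> cstar_arrow (Aof p) (Aof a) (j a p))
   \<and> (\<forall>p p' p''. cs_le K p p' \<and> cs_le K p' p'' \<longrightarrow>
        (\<forall>x\<in>carrier (Aof p). j p'' p' (j p' p x) = j p'' p x))"

definition causal_net :: "'a causet \<Rightarrow> ('a \<Rightarrow> 'b cstar) \<Rightarrow> ('a \<Rightarrow> 'a \<Rightarrow> 'b \<Rightarrow> 'b) \<Rightarrow> bool" where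
  "causal_net K Aof j \<longleftrightarrow> cnet K Aof j \<and>
     (\<forall>a o1 o2. cs_le K o1 a \<and> cs_le K o2 a \<and> cs_perp K o1 o2 \<longrightarrow>
        (\<forall>x\<in>carrier (Aof o1). \<forall>y\<in>carrier (Aof o2).
           mult (Aof a) (j a o1 x) (j a o2 y) = mult (Aof a) (j a o2 y) (j a o1 x)))"

definition covariant_net ::
  "'a causet \<Rightarrow> ('a \<Rightarrow> 'a) set \<Rightarrow> ('a \<Rightarrow> 'b cstar) \<Rightarrow> ('a \<Rightarrow> 'a \<Rightarrow> 'b \<Rightarrow> 'b)
     \<Rightarrow> (('a \<Rightarrow> 'a) \<Rightarrow> 'a \<Rightarrow> 'b \<Rightarrow> 'b) \<Rightarrow> bool" where
  "covariant_net K S Aof j alpha \<longleftrightarrow> cnet K Aof j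
   \<and> (\<forall>g\<in>S. \<forall>p\<in>cs_carrier K. star_iso (Aof p) (Aof (g p)) (alpha g p))
   \<and> (\<forall>g\<in>S. \<forall>h\<in>S. \<forall>p\<in>cs_carrier K. \<forall>x\<in>carrier (Aof p).
        alpha g (h p) (alpha h p x) = alpha (compose (cs_carrier K) g h) p x)
   \<and> (\<forall>g\<in>S. \<forall>p a. cs_le K p a \<longrightarrow> (\<forall>x\<in>carrier (Aof p).
        alpha g a (j a p x) = j (g a) (g p) (alpha g p x)))"

definition local_alg ::
  "('a causet \<Rightarrow> 'b cstar) \<Rightarrow> ('a causet \<Rightarrow> 'a causet \<Rightarrow> ('a \<Rightarrow> 'a) \<Rightarrow> 'b \<Rightarrow> 'b)
     \<Rightarrow> 'a causet \<Rightarrow> 'a \<Rightarrow> 'b set" where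
  "local_alg Aobj Amor K p = Amor (below K p) K (incl K p) ` carrier (Aobj (below K p))"

end

theory Submission
  imports Defs
begin

text \<open>The substance is that an injective \<open>*\<close>-homomorphism \<open>f\<close> of \<open>C\<^sup>*\<close>-algebras is
  isometric, so that its image is closed; the rest is functoriality applied to
  \<open>s \<circ> incl K p = incl K (s p) \<circ> s\<close> on \<open>below K p\<close>. Spectral theory is avoided: the only
  analytic input is a norm convergent iteration for \<open>\<surd>(1 - x)\<close> with \<open>x\<close> self-adjoint and
  \<open>\<parallel>x\<parallel> \<le> 1\<close>, combined with the remark that \<open>n\<^sup>2 + a\<^sup>2 = \<lambda>\<close> for commuting self-adjoint
  \<open>n\<close> and \<open>a\<close> forces \<open>\<parallel>a\<parallel>\<^sup>2 \<le> \<lambda>\<close>.\<close>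

section \<open>Arithmetic in a C*-algebra\<close>

text \<open>A homomorphism preserves equations and not, a priori, norms, so each norm bound is first
  turned into an equation. For commuting self-adjoint n and a, the equation n^2 + a^2 = l is a
  certificate that ||a||^2 is at most l. Applying \<open>f\<close> to a certificate yields one in
  the target, which gives contractivity; a certificate found in the domain with l too small for
  ||a|| refutes a drop of the norm, which gives isometry. Square roots supply the missing n. The
  factorization (n - i a)(n + i a) leaves a commutator unless n and a commute; therefore each root
  is delivered with the fact that it commutes with everything that commutes with its argument.
  Positivity of a self-adjoint y is never introduced as a notion: the bound ||1 - y|| <= 1 stands in
  for it, and it is what a further square root requires. Isometry is unavoidable because
  \<open>local_alg\<close> is only an image: both its closedness in \<open>Aobj K\<close> and its
  completeness as an algebra of the net depend on it.\<close>

definition diff :: "'b cstar \<Rightarrow> 'b \<Rightarrow> 'b \<Rightarrow> 'b" where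
  "diff C x y = add C x (smult C (-1) y)"

locale cstar_algebra =
  fixes C :: "'b cstar" (structure)
  assumes cstar_alg: "cstar_alg C"
begin

notation add (infixl "\<oplus>\<index>" 65)
notation diff (infixl "\<ominus>\<index>" 65)
notation mult (infixl "\<otimes>\<index>" 70)
notation smult (infixr "\<odot>\<index>" 75)

lemma
  shows zero_closed [simp]: "zero C \<in> carrier C"
    and one_closed [simp]: "one C \<in> carrier C"
    and add_closed [simp]: "\<lbrakk>x \<in> carrier C; y \<in> carrier C\<rbrakk> \<Longrightarrow> x \<oplus> y \<in> carrier C"
    and mult_closed [simp]: "\<lbrakk>x \<in> carrier C; y \<in> carrier C\<rbrakk> \<Longrightarrow> x \<otimes> y \<in> carrier C"
    and smult_closed [simp]: "x \<in> carrier C \<Longrightarrow> a \<odot> x \<in> carrier C"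
    and star_closed [simp]: "x \<in> carrier C \<Longrightarrow> star C x \<in> carrier C"
  using cstar_alg by (simp_all add: cstar_alg_def Let_def)

lemma add_assoc: "\<lbrakk>x \<in> carrier C; y \<in> carrier C; z \<in> carrier C\<rbrakk> \<Longrightarrow> x \<oplus> y \<oplus> z = x \<oplus> (y \<oplus> z)"
proof -
  have "\<forall>x\<in>carrier C. \<forall>y\<in>carrier C. \<forall>z\<in>carrier C. x \<oplus> y \<oplus> z = x \<oplus> (y \<oplus> z)"
    using cstar_alg unfolding cstar_alg_def Let_def by (elim conjE)
  then show "\<lbrakk>x \<in> carrier C; y \<in> carrier C; z \<in> carrier C\<rbrakk> \<Longrightarrow> x \<oplus> y \<oplus> z = x \<oplus> (y \<oplus> z)"
    by blast
qed

lemma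
  shows add_commute: "\<lbrakk>x \<in> carrier C; y \<in> carrier C\<rbrakk> \<Longrightarrow> x \<oplus> y = y \<oplus> x"
    and add_zero [simp]: "x \<in> carrier C \<Longrightarrow> x \<oplus> zero C = x"
    and add_neg: "x \<in> carrier C \<Longrightarrow> x \<oplus> (-1) \<odot> x = zero C"
    and smult_add: "\<lbrakk>x \<in> carrier C; y \<in> carrier C\<rbrakk> \<Longrightarrow> a \<odot> (x \<oplus> y) = a \<odot> x \<oplus> a \<odot> y"
    and add_smult: "x \<in> carrier C \<Longrightarrow> (a + b) \<odot> x = a \<odot> x \<oplus> b \<odot> x"
    and smult_smult [simp]: "x \<in> carrier C \<Longrightarrow> a \<odot> b \<odot> x = (a * b) \<odot> x"
    and smult_one [simp]: "x \<in> carrier C \<Longrightarrow> 1 \<odot> x = x"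
  using cstar_alg by (simp_all add: cstar_alg_def Let_def)

lemma
  shows mult_assoc: "\<lbrakk>x \<in> carrier C; y \<in> carrier C; z \<in> carrier C\<rbrakk> \<Longrightarrow> x \<otimes> y \<otimes> z = x \<otimes> (y \<otimes> z)"
    and mult_add: "\<lbrakk>x \<in> carrier C; y \<in> carrier C; z \<in> carrier C\<rbrakk> \<Longrightarrow> x \<otimes> (y \<oplus> z) = x \<otimes> y \<oplus> x \<otimes> z"
    and add_mult: "\<lbrakk>x \<in> carrier C; y \<in> carrier C; z \<in> carrier C\<rbrakk> \<Longrightarrow> (x \<oplus> y) \<otimes> z = x \<otimes> z \<oplus> y \<otimes> z"
    and smult_mult [simp]: "\<lbrakk>x \<in> carrier C; y \<in> carrier C\<rbrakk> \<Longrightarrow> (a \<odot> x) \<otimes> y = a \<odot> (x \<otimes> y)"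
    and mult_smult [simp]: "\<lbrakk>x \<in> carrier C; y \<in> carrier C\<rbrakk> \<Longrightarrow> x \<otimes> (a \<odot> y) = a \<odot> (x \<otimes> y)"
    and one_mult [simp]: "x \<in> carrier C \<Longrightarrow> one C \<otimes> x = x"
    and mult_one [simp]: "x \<in> carrier C \<Longrightarrow> x \<otimes> one C = x"
  using cstar_alg by (simp_all add: cstar_alg_def Let_def)

lemma
  shows star_add: "\<lbrakk>x \<in> carrier C; y \<in> carrier C\<rbrakk> \<Longrightarrow> star C (x \<oplus> y) = star C x \<oplus> star C y"
    and star_smult [simp]: "x \<in> carrier C \<Longrightarrow> star C (a \<odot> x) = cnj a \<odot> star C x"
    and star_mult [simp]: "\<lbrakk>x \<in> carrier C; y \<in> carrier C\<rbrakk> \<Longrightarrow> star C (x \<otimes> y) = star C y \<otimes> star C x"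
    and star_star [simp]: "x \<in> carrier C \<Longrightarrow> star C (star C x) = x"
  using cstar_alg by (simp_all add: cstar_alg_def Let_def)

lemma
  shows cnorm_nonneg [simp]: "x \<in> carrier C \<Longrightarrow> 0 \<le> cnorm C x"
    and cnorm_eq_0_iff: "x \<in> carrier C \<Longrightarrow> cnorm C x = 0 \<longleftrightarrow> x = zero C"
    and cnorm_smult [simp]: "x \<in> carrier C \<Longrightarrow> cnorm C (a \<odot> x) = cmod a * cnorm C x"
    and cnorm_add_le: "\<lbrakk>x \<in> carrier C; y \<in> carrier C\<rbrakk> \<Longrightarrow> cnorm C (x \<oplus> y) \<le> cnorm C x + cnorm C y"
    and cnorm_mult_le: "\<lbrakk>x \<in> carrier C; y \<in> carrier C\<rbrakk> \<Longrightarrow> cnorm C (x \<otimes> y) \<le> cnorm C x * cnorm C y"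
    and cnorm_star_mult: "x \<in> carrier C \<Longrightarrow> cnorm C (star C x \<otimes> x) = (cnorm C x)\<^sup>2"
  using cstar_alg by (simp_all add: cstar_alg_def Let_def)

lemma Cauchy_imp_limit:
  assumes "\<And>n. f n \<in> carrier C"
    and "\<And>e. e > 0 \<Longrightarrow> \<exists>N::nat. \<forall>m\<ge>N. \<forall>n\<ge>N. cdist C (f m) (f n) < e"
  obtains x where "x \<in> carrier C" "\<And>e. e > 0 \<Longrightarrow> \<exists>N::nat. \<forall>n\<ge>N. cdist C (f n) x < e"
proof -
  have "\<forall>f. (\<forall>n. f n \<in> carrier C) \<and> (\<forall>e>0. \<exists>N::nat. \<forall>m\<ge>N. \<forall>n\<ge>N. cdist C (f m) (f n) < e)
            \<longrightarrow> (\<exists>x\<in>carrier C. \<forall>e>0. \<exists>N::nat. \<forall>n\<ge>N. cdist C (f n) x < e)"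
    using cstar_alg unfolding cstar_alg_def Let_def by blast
  with assms that show thesis by blast
qed

lemma cdist_eq: "cdist C x y = cnorm C (x \<ominus> y)"
  by (simp add: cdist_def diff_def)

section \<open>Additive arithmetic and subtraction\<close>

lemma zero_add [simp]: "x \<in> carrier C \<Longrightarrow> zero C \<oplus> x = x"
  by (simp add: add_commute[of "zero C"])

lemma add_left_commute:
  "\<lbrakk>x \<in> carrier C; y \<in> carrier C; z \<in> carrier C\<rbrakk> \<Longrightarrow> x \<oplus> (y \<oplus> z) = y \<oplus> (x \<oplus> z)"
  by (metis add_assoc add_commute)

lemmas add_ac = add_assoc add_commute add_left_commute

lemma diff_closed [simp]: "\<lbrakk>x \<in> carrier C; y \<in> carrier C\<rbrakk> \<Longrightarrow> x \<ominus> y \<in> carrier C"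
  by (simp add: diff_def)

lemma diff_self [simp]: "x \<in> carrier C \<Longrightarrow> x \<ominus> x = zero C"
  by (simp add: diff_def add_neg)

text \<open>Oriented towards \<open>diff\<close>, so proofs that unfold \<open>diff_def\<close>
  afterwards must delete this rule.\<close>

lemma add_minus_smult [simp]: "x \<oplus> (-1) \<odot> y = x \<ominus> y"
  by (simp add: diff_def)

lemma diff_eq_iff:
  assumes "x \<in> carrier C" "y \<in> carrier C" "z \<in> carrier C"
  shows "x \<ominus> y = z \<longleftrightarrow> x = z \<oplus> y"
proof
  assume "x \<ominus> y = z"
  then have "z \<oplus> y = x \<oplus> (y \<ominus> y)"
    using assms by (auto simp add: diff_def add_ac simp del: add_minus_smult)
  then show "x = z \<oplus> y" using assms by simp
next
  assume "x = z \<oplus> y"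
  then have "x \<ominus> y = z \<oplus> (y \<ominus> y)"
    using assms by (simp add: diff_def add_assoc del: add_minus_smult)
  then show "x \<ominus> y = z" using assms by simp
qed

lemma eq_diff_iff:
  "\<lbrakk>x \<in> carrier C; y \<in> carrier C; z \<in> carrier C\<rbrakk> \<Longrightarrow> z = x \<ominus> y \<longleftrightarrow> z \<oplus> y = x"
  using diff_eq_iff by metis

lemma diff_add_cancel [simp]: "\<lbrakk>x \<in> carrier C; y \<in> carrier C\<rbrakk> \<Longrightarrow> x \<ominus> y \<oplus> y = x"
  using diff_eq_iff[of x y "x \<ominus> y"] by simp

lemma add_diff_cancel [simp]: "\<lbrakk>x \<in> carrier C; y \<in> carrier C\<rbrakk> \<Longrightarrow> y \<oplus> (x \<ominus> y) = x"
  by (simp add: add_commute[of y])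

lemma diff_zero [simp]: "x \<in> carrier C \<Longrightarrow> x \<ominus> zero C = x"
  by (simp add: diff_eq_iff)

lemma add_diff_eq:
  assumes "x \<in> carrier C" "y \<in> carrier C" "z \<in> carrier C"
  shows "x \<oplus> (y \<ominus> z) = x \<oplus> y \<ominus> z"
  using assms by (simp add: diff_def add_assoc del: add_minus_smult)

lemma diff_add_eq:
  assumes "x \<in> carrier C" "y \<in> carrier C" "z \<in> carrier C"
  shows "x \<ominus> y \<oplus> z = x \<oplus> z \<ominus> y"
  using assms by (simp add: diff_def add_ac del: add_minus_smult)

lemma diff_diff_eq:
  assumes "x \<in> carrier C" "y \<in> carrier C" "z \<in> carrier C"
  shows "x \<ominus> y \<ominus> z = x \<ominus> (y \<oplus> z)"
  using assms by (simp add: diff_def smult_add add_assoc del: add_minus_smult)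

lemma diff_diff_eq2:
  assumes "x \<in> carrier C" "y \<in> carrier C" "z \<in> carrier C"
  shows "x \<ominus> (y \<ominus> z) = x \<oplus> z \<ominus> y"
  using assms by (simp add: diff_def smult_add add_ac del: add_minus_smult)

lemma smult_diff:
  "\<lbrakk>x \<in> carrier C; y \<in> carrier C\<rbrakk> \<Longrightarrow> a \<odot> (x \<ominus> y) = a \<odot> x \<ominus> a \<odot> y"
  by (simp add: diff_def smult_add del: add_minus_smult)

lemma mult_diff:
  "\<lbrakk>x \<in> carrier C; y \<in> carrier C; z \<in> carrier C\<rbrakk> \<Longrightarrow> x \<otimes> (y \<ominus> z) = x \<otimes> y \<ominus> x \<otimes> z"
  by (simp add: diff_def mult_add del: add_minus_smult)

lemma diff_mult:
  "\<lbrakk>x \<in> carrier C; y \<in> carrier C; z \<in> carrier C\<rbrakk> \<Longrightarrow> (x \<ominus> y) \<otimes> z = x \<otimes> z \<ominus> y \<otimes> z"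
  by (simp add: diff_def add_mult del: add_minus_smult)

lemma star_diff:
  "\<lbrakk>x \<in> carrier C; y \<in> carrier C\<rbrakk> \<Longrightarrow> star C (x \<ominus> y) = star C x \<ominus> star C y"
  by (simp add: diff_def star_add del: add_minus_smult)

text \<open>Products are expanded, subtractions are moved outwards and then across the equation;
  what remains is an equality of sums, decided by \<open>add_ac\<close>.\<close>

lemmas ring_simps = add_ac add_diff_eq diff_add_eq diff_diff_eq diff_diff_eq2 diff_eq_iff eq_diff_iff
  smult_add smult_diff mult_add mult_diff add_mult diff_mult

section \<open>Norm and distance estimates\<close>

lemma cnorm_zero [simp]: "cnorm C (zero C) = 0"
  by (simp add: cnorm_eq_0_iff)

lemma zero_smult [simp]: "x \<in> carrier C \<Longrightarrow> 0 \<odot> x = zero C"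
  using cnorm_smult[of x 0] cnorm_eq_0_iff[of "0 \<odot> x"] by simp

lemma zero_mult [simp]: "x \<in> carrier C \<Longrightarrow> zero C \<otimes> x = zero C"
  using smult_mult[of "zero C" x 0] by simp

lemma star_zero [simp]: "star C (zero C) = zero C"
  using star_smult[of "zero C" 0] by simp

lemma star_one [simp]: "star C (one C) = one C"
  using star_mult[of "star C (one C)" "one C"] by simp

text \<open>By the C*-identity this norm equals its own square. The value 0 does occur, since the
  axioms admit the zero algebra, hence only an inequality.\<close>

lemma cnorm_one_le: "cnorm C (one C) \<le> 1"
proof -
  have "cnorm C (one C) = (cnorm C (one C))\<^sup>2"
    using cnorm_star_mult[of "one C"] by simp
  then have "cnorm C (one C) = 0 \<or> cnorm C (one C) = 1"
    by (simp add: power2_eq_square)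
  then show ?thesis by auto
qed

text \<open>One factor of ||y||^2 = ||y* y|| <= ||y*|| ||y|| cancels; using this for x and for its
  adjoint gives both inequalities.\<close>

lemma cnorm_star [simp]:
  assumes "x \<in> carrier C" shows "cnorm C (star C x) = cnorm C x"
proof -
  have le: "cnorm C y \<le> cnorm C (star C y)" if "y \<in> carrier C" for y
  proof (cases "cnorm C y = 0")
    case False
    have "cnorm C y * cnorm C y \<le> cnorm C (star C y) * cnorm C y"
      using cnorm_star_mult[of y] cnorm_mult_le[of "star C y" y] that by (simp add: power2_eq_square)
    then show ?thesis using False that less_le[of 0 "cnorm C y"] by (auto simp: mult_le_cancel_right)
  qed (use that in simp)
  show ?thesis using le[of x] le[of "star C x"] assms by simp
qed

lemma cnorm_square:
  "\<lbrakk>x \<in> carrier C; star C x = x\<rbrakk> \<Longrightarrow> cnorm C (x \<otimes> x) = (cnorm C x)\<^sup>2"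
  using cnorm_star_mult[of x] by simp

lemma cnorm_diff_le:
  assumes "x \<in> carrier C" "y \<in> carrier C"
  shows "cnorm C (x \<ominus> y) \<le> cnorm C x + cnorm C y"
  using cnorm_add_le[of x "(-1) \<odot> y"] assms by simp

lemma cdist_commute:
  assumes "x \<in> carrier C" "y \<in> carrier C" shows "cdist C x y = cdist C y x"
proof -
  have "y \<ominus> x = (-1) \<odot> (x \<ominus> y)"
    using assms by (simp add: diff_def smult_add add_commute del: add_minus_smult)
  then show ?thesis using assms by (simp add: cdist_eq)
qed

lemma diff_add_diff:
  "\<lbrakk>x \<in> carrier C; y \<in> carrier C; z \<in> carrier C\<rbrakk> \<Longrightarrow> (x \<ominus> y) \<oplus> (y \<ominus> z) = x \<ominus> z"
  by (simp add: ring_simps)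

lemma cdist_triangle:
  assumes "x \<in> carrier C" "y \<in> carrier C" "z \<in> carrier C"
  shows "cdist C x z \<le> cdist C x y + cdist C y z"
  using cnorm_add_le[of "x \<ominus> y" "y \<ominus> z"] assms by (simp add: cdist_eq diff_add_diff)

lemma cdist_nonneg [simp]: "\<lbrakk>x \<in> carrier C; y \<in> carrier C\<rbrakk> \<Longrightarrow> 0 \<le> cdist C x y"
  by (simp add: cdist_eq)

lemma cdist_self [simp]: "x \<in> carrier C \<Longrightarrow> cdist C x x = 0"
  by (simp add: cdist_eq)

lemma cdist_eq_0D:
  assumes "x \<in> carrier C" "y \<in> carrier C" "cdist C x y = 0" shows "x = y"
  using assms by (simp add: cdist_eq cnorm_eq_0_iff diff_eq_iff)

lemma cdist_mult_le:
  assumes "p \<in> carrier C" "p' \<in> carrier C" "q \<in> carrier C" "q' \<in> carrier C"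
  shows "cdist C (p \<otimes> p') (q \<otimes> q') \<le> cnorm C p * cdist C p' q' + cdist C p q * cnorm C q'"
proof -
  have "p \<otimes> p' \<ominus> q \<otimes> q' = p \<otimes> (p' \<ominus> q') \<oplus> (p \<ominus> q) \<otimes> q'"
    using assms by (simp add: ring_simps)
  then show ?thesis
    using cnorm_add_le[of "p \<otimes> (p' \<ominus> q')" "(p \<ominus> q) \<otimes> q'"]
      cnorm_mult_le[of p "p' \<ominus> q'"] cnorm_mult_le[of "p \<ominus> q" q'] assms by (simp add: cdist_eq)
qed

lemma add_diff_add_left:
  "\<lbrakk>x \<in> carrier C; y \<in> carrier C; z \<in> carrier C\<rbrakk> \<Longrightarrow> (x \<oplus> y) \<ominus> (x \<oplus> z) = y \<ominus> z"
  by (simp add: ring_simps)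

text \<open>Tailored to two values of one iteration step of \<open>sqrt_iter\<close>, whose common
  summand cancels.\<close>

lemma cdist_smult_add_left:
  assumes "x \<in> carrier C" "y \<in> carrier C" "z \<in> carrier C"
  shows "cdist C (a \<odot> (x \<oplus> y)) (a \<odot> (x \<oplus> z)) = cmod a * cdist C y z"
  using assms by (simp add: cdist_eq add_diff_add_left smult_diff[symmetric])

lemma cdist_star:
  "\<lbrakk>x \<in> carrier C; y \<in> carrier C\<rbrakk> \<Longrightarrow> cdist C (star C x) (star C y) = cdist C x y"
  by (simp add: cdist_eq star_diff[symmetric])

text \<open>The device for proving equations about limits: one sequence is shown to converge to both
  sides.\<close>

lemma limit_unique:
  assumes "\<And>n. f n \<in> carrier C" "x \<in> carrier C" "y \<in> carrier C"
    and "(\<lambda>n. cdist C (f n) x) \<longlonglongrightarrow> 0" "(\<lambda>n. cdist C (f n) y) \<longlonglongrightarrow> 0"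
  shows "x = y"
proof -
  have "(\<lambda>n. cdist C (f n) x + cdist C (f n) y) \<longlonglongrightarrow> 0 + 0"
    by (intro tendsto_add assms)
  moreover have "cdist C x y \<le> cdist C (f n) x + cdist C (f n) y" for n
    using cdist_triangle[of x "f n" y] cdist_commute[of x "f n"] assms(1-3) by simp
  ultimately have "cdist C x y \<le> 0"
    using LIMSEQ_le_const[of _ 0 "cdist C x y"] by auto
  then show ?thesis
    using cdist_nonneg[of x y] assms(2,3) by (intro cdist_eq_0D antisym)
qed

end

section \<open>Square roots\<close>

primrec sqrt_iter :: "'b cstar \<Rightarrow> 'b \<Rightarrow> nat \<Rightarrow> 'b" where
  "sqrt_iter C x 0 = zero C"
| "sqrt_iter C x (Suc n) = smult C (1/2) (add C x (mult C (sqrt_iter C x n) (sqrt_iter C x n)))"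

text \<open>The fixed point equation t = (1 + t^2) / 2 has 1 as a double root, so convergence has no
  geometric rate. The Cauchy property has to come from monotonicity and boundedness.\<close>

primrec sqrt_majorant :: "nat \<Rightarrow> real" where
  "sqrt_majorant 0 = 0"
| "sqrt_majorant (Suc n) = (1 + (sqrt_majorant n)\<^sup>2) / 2"

lemma sqrt_majorant_bounds: "0 \<le> sqrt_majorant n \<and> sqrt_majorant n \<le> 1"
proof (induction n)
  case (Suc n)
  then have "(sqrt_majorant n)\<^sup>2 \<le> 1" by (simp add: power_le_one)
  then show ?case by simp
qed simp

lemma sqrt_majorant_incseq: "incseq sqrt_majorant"
proof (rule incseq_SucI)
  fix n show "sqrt_majorant n \<le> sqrt_majorant (Suc n)"
    using sum_squares_bound[of 1 "sqrt_majorant n"] by simp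
qed

lemma sqrt_majorant_Cauchy: "Cauchy sqrt_majorant"
proof -
  obtain L where "sqrt_majorant \<longlonglongrightarrow> L"
    using incseq_convergent[OF sqrt_majorant_incseq, of 1] sqrt_majorant_bounds by blast
  then show ?thesis by (rule LIMSEQ_imp_Cauchy)
qed

context cstar_algebra
begin

lemma sqrt_iter_closed [simp]: "x \<in> carrier C \<Longrightarrow> sqrt_iter C x n \<in> carrier C"
  by (induction n) auto

lemma cnorm_sqrt_iter_le:
  assumes "x \<in> carrier C" "cnorm C x \<le> 1"
  shows "cnorm C (sqrt_iter C x n) \<le> sqrt_majorant n"
proof (induction n)
  case (Suc n)
  let ?s = "sqrt_iter C x n"
  have "cnorm C (x \<oplus> ?s \<otimes> ?s) \<le> cnorm C x + cnorm C ?s * cnorm C ?s"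
    using cnorm_add_le[of x "?s \<otimes> ?s"] cnorm_mult_le[of ?s ?s] assms(1) by simp
  also have "\<dots> \<le> 1 + sqrt_majorant n * sqrt_majorant n"
    using assms Suc by (intro add_mono mult_mono) (auto simp: sqrt_majorant_bounds)
  finally show ?case
    using assms(1) by (simp add: power2_eq_square norm_divide)
qed simp

text \<open>Squaring preserves the domination: ||s s - t t|| <= ||s|| ||s - t|| + ||s - t|| ||t||,
  and for the real majorants the corresponding expression is exactly p^2 - q^2.\<close>

lemma cdist_sqrt_iter_Suc_le:
  assumes x: "x \<in> carrier C" "cnorm C x \<le> 1"
  shows "cdist C (sqrt_iter C x (Suc n)) (sqrt_iter C x n)
    \<le> sqrt_majorant (Suc n) - sqrt_majorant n"
proof (induction n)
  case 0
  show ?case using assms by (simp add: cdist_eq norm_divide)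
next
  case (Suc n)
  let ?s = "sqrt_iter C x (Suc n)" and ?t = "sqrt_iter C x n"
  let ?p = "sqrt_majorant (Suc n)" and ?q = "sqrt_majorant n"
  have c: "?s \<in> carrier C" "?t \<in> carrier C" using x(1) sqrt_iter_closed by blast+
  have "cdist C (?s \<otimes> ?s) (?t \<otimes> ?t) \<le> cnorm C ?s * cdist C ?s ?t + cdist C ?s ?t * cnorm C ?t"
    by (intro cdist_mult_le c)
  also have "\<dots> \<le> ?p * (?p - ?q) + (?p - ?q) * ?q"
    using c Suc.IH cnorm_sqrt_iter_le[OF x, of n] cnorm_sqrt_iter_le[OF x, of "Suc n"]
      sqrt_majorant_bounds[of n] sqrt_majorant_bounds[of "Suc n"] incseq_SucD[OF sqrt_majorant_incseq, of n]
    by (intro add_mono mult_mono) (simp_all del: sqrt_iter.simps sqrt_majorant.simps)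
  also have "\<dots> = ?p\<^sup>2 - ?q\<^sup>2"
    by (simp add: algebra_simps power2_eq_square del: sqrt_majorant.simps)
  finally have "cdist C (?s \<otimes> ?s) (?t \<otimes> ?t) \<le> ?p\<^sup>2 - ?q\<^sup>2" .
  moreover have "cdist C (sqrt_iter C x (Suc (Suc n))) ?s = 1/2 * cdist C (?s \<otimes> ?s) (?t \<otimes> ?t)"
    using c x(1) cdist_smult_add_left[of x "?s \<otimes> ?s" "?t \<otimes> ?t" "1/2"] by (simp add: norm_divide)
  moreover have "sqrt_majorant (Suc (Suc n)) - ?p = 1/2 * (?p\<^sup>2 - ?q\<^sup>2)"
    by (simp add: field_simps)
  ultimately show ?case by (simp del: sqrt_iter.simps sqrt_majorant.simps)
qed

lemma cdist_sqrt_iter_le: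
  assumes x: "x \<in> carrier C" "cnorm C x \<le> 1" and "m \<le> n"
  shows "cdist C (sqrt_iter C x n) (sqrt_iter C x m) \<le> sqrt_majorant n - sqrt_majorant m"
  using \<open>m \<le> n\<close>
proof (induction n rule: dec_induct)
  case base
  show ?case using x by simp
next
  case (step n)
  have "cdist C (sqrt_iter C x (Suc n)) (sqrt_iter C x m)
    \<le> cdist C (sqrt_iter C x (Suc n)) (sqrt_iter C x n) + cdist C (sqrt_iter C x n) (sqrt_iter C x m)"
    using x(1) by (intro cdist_triangle sqrt_iter_closed)
  then show ?case using step.IH cdist_sqrt_iter_Suc_le[OF x, of n] by linarith
qed

lemma sqrt_iter_limit:
  assumes x: "x \<in> carrier C" "cnorm C x \<le> 1"
  obtains s where "s \<in> carrier C" "(\<lambda>n. cdist C (sqrt_iter C x n) s) \<longlonglongrightarrow> 0"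
proof -
  have "\<exists>N. \<forall>m\<ge>N. \<forall>n\<ge>N. cdist C (sqrt_iter C x m) (sqrt_iter C x n) < e" if "e > 0" for e
  proof -
    obtain N where N: "\<forall>m\<ge>N. \<forall>n\<ge>N. dist (sqrt_majorant m) (sqrt_majorant n) < e"
      using sqrt_majorant_Cauchy \<open>e > 0\<close> unfolding Cauchy_def by blast
    have le: "cdist C (sqrt_iter C x m) (sqrt_iter C x n) \<le> dist (sqrt_majorant m) (sqrt_majorant n)"
      for m n
      using cdist_sqrt_iter_le[OF x, of n m] cdist_sqrt_iter_le[OF x, of m n]
        cdist_commute[of "sqrt_iter C x m" "sqrt_iter C x n"] x(1)
      by (cases "n \<le> m") (auto simp: dist_real_def)
    show ?thesis using N le by (meson le_less_trans)
  qed
  then obtain s where s: "s \<in> carrier C"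
    and lim: "\<And>e. e > 0 \<Longrightarrow> \<exists>N. \<forall>n\<ge>N. cdist C (sqrt_iter C x n) s < e"
    using Cauchy_imp_limit[of "sqrt_iter C x"] x(1) by (metis sqrt_iter_closed)
  have "(\<lambda>n. cdist C (sqrt_iter C x n) s) \<longlonglongrightarrow> 0"
    using lim s x(1) by (auto simp: LIMSEQ_iff)
  with s that show thesis by blast
qed

lemma star_sqrt_iter:
  assumes "x \<in> carrier C" "star C x = x"
  shows "star C (sqrt_iter C x n) = sqrt_iter C x n"
  using assms by (induction n) (auto simp: star_add)

text \<open>Every iterate is a polynomial in \<open>x\<close>.\<close>

lemma sqrt_iter_mult_commute:
  assumes "x \<in> carrier C" "z \<in> carrier C" "x \<otimes> z = z \<otimes> x"
  shows "sqrt_iter C x n \<otimes> z = z \<otimes> sqrt_iter C x n"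
proof (induction n)
  case 0
  have "z \<otimes> zero C = zero C" using assms mult_smult[of z "zero C" 0] by simp
  then show ?case using assms by simp
next
  case (Suc n)
  let ?s = "sqrt_iter C x n"
  have "?s \<otimes> ?s \<otimes> z = z \<otimes> (?s \<otimes> ?s)"
    using assms(1,2) Suc by (metis mult_assoc sqrt_iter_closed)
  then show ?case using assms by (simp add: ring_simps)
qed

text \<open>The iteration is the fixed point scheme for \<open>s = (x + s\<^sup>2) / 2\<close>, that is,
  \<open>(1 - s)\<^sup>2 = 1 - x\<close>. It converges even for \<open>\<parallel>x\<parallel> = 1\<close>, because its increments
  are dominated by those of the same scheme for the real number \<open>1\<close>.\<close>

lemma sqrt_exists:
  assumes x: "x \<in> carrier C" "cnorm C x \<le> 1" and sa: "star C x = x"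
  obtains y where "y \<in> carrier C" "star C y = y" "y \<otimes> y = one C \<ominus> x" "cnorm C (one C \<ominus> y) \<le> 1"
    "\<And>z. \<lbrakk>z \<in> carrier C; x \<otimes> z = z \<otimes> x\<rbrakk> \<Longrightarrow> y \<otimes> z = z \<otimes> y"
proof -
  let ?S = "sqrt_iter C x"
  have S [simp]: "?S n \<in> carrier C" for n using x(1) by simp
  have S_le: "cnorm C (?S n) \<le> 1" for n
    using cnorm_sqrt_iter_le[OF x, of n] sqrt_majorant_bounds[of n] by linarith
  obtain s where s [simp]: "s \<in> carrier C" and lim: "(\<lambda>n. cdist C (?S n) s) \<longlonglongrightarrow> 0"
    using sqrt_iter_limit[OF x] by blast
  have s_le: "cnorm C s \<le> 1"
  proof -
    have "cnorm C s \<le> 1 + cdist C (?S n) s" for n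
    proof -
      have "s = ?S n \<ominus> (?S n \<ominus> s)" by (simp add: ring_simps)
      then have "cnorm C s \<le> cnorm C (?S n) + cnorm C (?S n \<ominus> s)"
        using cnorm_diff_le[of "?S n" "?S n \<ominus> s"] by simp
      then show ?thesis using S_le[of n] by (simp add: cdist_eq)
    qed
    moreover have "(\<lambda>n. 1 + cdist C (?S n) s) \<longlonglongrightarrow> 1 + 0"
      by (intro tendsto_add tendsto_const lim)
    ultimately show ?thesis using LIMSEQ_le_const[of _ 1 "cnorm C s"] by auto
  qed
  \<comment> \<open>The squeeze used below: a sequence converges to l if its distance from l is at
    most a fixed multiple of the distance of the iterates from s.\<close>
  have small: "(\<lambda>n. cdist C (f n) l) \<longlonglongrightarrow> 0"
    if "\<And>n. f n \<in> carrier C" "l \<in> carrier C" "\<And>n. cdist C (f n) l \<le> c * cdist C (?S n) s" for f l c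
  proof (rule tendsto_sandwich[OF _ _ tendsto_const])
    show "(\<lambda>n. c * cdist C (?S n) s) \<longlonglongrightarrow> 0"
      using tendsto_mult_right_zero[OF lim] by simp
  qed (use that in auto)
  have star_s: "star C s = s"
  proof (rule limit_unique[of ?S])
    show "(\<lambda>n. cdist C (?S n) (star C s)) \<longlonglongrightarrow> 0"
      using small[of ?S "star C s" 1] cdist_star[of "?S _" s] star_sqrt_iter[OF x(1) sa] by simp
  qed (simp_all add: lim)
  have fix_s: "s = (1/2) \<odot> (x \<oplus> s \<otimes> s)"
  proof (rule limit_unique[of "\<lambda>n. ?S (Suc n)"])
    show "(\<lambda>n. cdist C (?S (Suc n)) s) \<longlonglongrightarrow> 0" using LIMSEQ_Suc[OF lim] .
    show "(\<lambda>n. cdist C (?S (Suc n)) ((1/2) \<odot> (x \<oplus> s \<otimes> s))) \<longlonglongrightarrow> 0"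
    \<comment> \<open>Squaring costs a factor of at most 2 on elements of norm at most 1, and the
      1/2 of the scheme absorbs it.\<close>
    proof (rule small[where c = 1])
      fix n
      have "cdist C (?S n \<otimes> ?S n) (s \<otimes> s) \<le> cnorm C (?S n) * cdist C (?S n) s + cdist C (?S n) s * cnorm C s"
        by (rule cdist_mult_le) simp_all
      also have "\<dots> \<le> 1 * cdist C (?S n) s + cdist C (?S n) s * 1"
        by (intro add_mono mult_mono S_le s_le) simp_all
      finally show "cdist C (?S (Suc n)) ((1/2) \<odot> (x \<oplus> s \<otimes> s)) \<le> 1 * cdist C (?S n) s"
        using cdist_smult_add_left[of x "?S n \<otimes> ?S n" "s \<otimes> s" "1/2"] x(1) by (simp add: norm_divide)
    qed (use x(1) in \<open>simp_all del: sqrt_iter.simps\<close>)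
  qed (use x(1) in \<open>simp_all del: sqrt_iter.simps\<close>)
  have comm_s: "s \<otimes> z = z \<otimes> s" if z: "z \<in> carrier C" "x \<otimes> z = z \<otimes> x" for z
  proof (rule limit_unique[of "\<lambda>n. ?S n \<otimes> z"])
    show "(\<lambda>n. cdist C (?S n \<otimes> z) (s \<otimes> z)) \<longlonglongrightarrow> 0"
      using cdist_mult_le[of "?S _" z s z] z(1)
      by (intro small[where c = "cnorm C z"]) (simp_all add: mult.commute)
    show "(\<lambda>n. cdist C (?S n \<otimes> z) (z \<otimes> s)) \<longlonglongrightarrow> 0"
      using cdist_mult_le[of z "?S _" z s] z(1) sqrt_iter_mult_commute[OF x(1) z]
      by (intro small[where c = "cnorm C z"]) simp_all
  qed (use z in simp_all)
  have two: "s \<oplus> s = x \<oplus> s \<otimes> s"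
  proof -
    have "s \<oplus> s = 2 \<odot> s" using add_smult[of s 1 1] by simp
    also have "\<dots> = 2 \<odot> ((1/2) \<odot> (x \<oplus> s \<otimes> s))" using fix_s by simp
    finally show ?thesis using x(1) by simp
  qed
  show thesis
  proof
    show "one C \<ominus> s \<in> carrier C" by simp
    show "star C (one C \<ominus> s) = one C \<ominus> s" by (simp add: star_diff star_s)
    show "(one C \<ominus> s) \<otimes> (one C \<ominus> s) = one C \<ominus> x"
      using x(1) two by (simp add: ring_simps)
    \<comment> \<open>This clause makes roots iterable: 1 minus the root is again an admissible
      argument, so the root has a root itself.\<close>
    have "one C \<ominus> (one C \<ominus> s) = s" by (simp add: ring_simps)
    then show "cnorm C (one C \<ominus> (one C \<ominus> s)) \<le> 1" using s_le by simp
    show "(one C \<ominus> s) \<otimes> z = z \<otimes> (one C \<ominus> s)" if "z \<in> carrier C" "x \<otimes> z = z \<otimes> x" for z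
      using that comm_s[OF that] by (simp add: mult_diff diff_mult)
  qed
qed

text \<open>The element \<open>u = n + \<i> a\<close> satisfies \<open>u\<^sup>* u = \<lambda>\<close>, and \<open>a\<close> is its imaginary part.\<close>

lemma cnorm_le_of_sum_squares:
  assumes n: "n \<in> carrier C" "star C n = n" and a: "a \<in> carrier C" "star C a = a"
    and comm: "n \<otimes> a = a \<otimes> n"
    and sum: "n \<otimes> n \<oplus> a \<otimes> a = complex_of_real l \<odot> one C" and l: "0 \<le> l"
  shows "(cnorm C a)\<^sup>2 \<le> l"
proof -
  define v where "v = \<i> \<odot> a"
  have v: "v \<in> carrier C" "star C v = (-1) \<odot> v" "n \<otimes> v = v \<otimes> n" "v \<otimes> v = (-1) \<odot> (a \<otimes> a)"
    using n a comm by (simp_all add: v_def)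
  define u where "u = n \<oplus> v"
  have u: "u \<in> carrier C" "star C u = n \<ominus> v"
    using n v by (simp_all add: u_def star_add)
  have "(n \<ominus> v) \<otimes> (n \<oplus> v) = n \<otimes> n \<ominus> v \<otimes> v"
    using n v(1,3) by (simp add: ring_simps)
  also have "\<dots> = n \<otimes> n \<oplus> a \<otimes> a"
    using n a v(4) by (simp add: diff_def del: add_minus_smult)
  finally have "(cnorm C u)\<^sup>2 = l * cnorm C (one C)"
    using cnorm_star_mult[OF u(1)] u(2) sum l by (simp add: u_def)
  also have "\<dots> \<le> l * 1"
    using l cnorm_one_le by (intro mult_left_mono) auto
  finally have *: "(cnorm C u)\<^sup>2 \<le> l" by simp
  have "u \<ominus> star C u = v \<oplus> v"
    unfolding u(2) using n v(1) by (simp add: u_def ring_simps)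
  also have "\<dots> = 2 \<odot> v" using add_smult[of v 1 1] v(1) by simp
  finally have "2 * cnorm C v \<le> cnorm C u + cnorm C u"
    using cnorm_diff_le[of u "star C u"] u(1) v(1) by simp
  then have "cnorm C a \<le> cnorm C u" using a(1) by (simp add: v_def)
  then have "(cnorm C a)\<^sup>2 \<le> (cnorm C u)\<^sup>2" using a(1) by (intro power_mono) auto
  with * show ?thesis by linarith
qed

end

section \<open>Injective homomorphisms\<close>

locale cstar_hom = C: cstar_algebra C + D: cstar_algebra D
  for C :: "'b cstar" and D :: "'b cstar" +
  fixes f :: "'b \<Rightarrow> 'b"
  assumes star_hom: "star_hom C D f"
begin

lemma
  shows hom_closed [simp]: "x \<in> carrier C \<Longrightarrow> f x \<in> carrier D"
    and hom_add: "\<lbrakk>x \<in> carrier C; y \<in> carrier C\<rbrakk> \<Longrightarrow> f (add C x y) = add D (f x) (f y)"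
    and hom_mult: "\<lbrakk>x \<in> carrier C; y \<in> carrier C\<rbrakk> \<Longrightarrow> f (mult C x y) = mult D (f x) (f y)"
    and hom_smult: "x \<in> carrier C \<Longrightarrow> f (smult C a x) = smult D a (f x)"
    and hom_star: "x \<in> carrier C \<Longrightarrow> f (star C x) = star D (f x)"
    and hom_one: "f (one C) = one D"
  using star_hom by (auto simp: star_hom_def)

lemma hom_diff:
  "\<lbrakk>x \<in> carrier C; y \<in> carrier C\<rbrakk> \<Longrightarrow> f (diff C x y) = diff D (f x) (f y)"
  unfolding diff_def by (simp add: hom_add hom_smult del: C.add_minus_smult D.add_minus_smult)

lemma hom_zero: "f (zero C) = zero D"
  using hom_smult[of "zero C" 0] by simp

text \<open>A self-adjoint \<open>a\<close> with \<open>\<parallel>a\<parallel> \<le> 1\<close> has a partner \<open>y\<close> with \<open>y\<^sup>2 + a\<^sup>2 = 1\<close>;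
  this relation is preserved by homomorphisms and bounds the norm of the image.\<close>

lemma cnorm_hom_le_1:
  assumes a: "a \<in> carrier C" "star C a = a" "cnorm C a \<le> 1"
  shows "cnorm D (f a) \<le> 1"
proof -
  have aa: "mult C a a \<in> carrier C" "star C (mult C a a) = mult C a a" using a by simp_all
  have "cnorm C (mult C a a) \<le> 1"
    using a by (simp add: C.cnorm_square power_le_one)
  from C.sqrt_exists[OF aa(1) this aa(2)] obtain y where y: "y \<in> carrier C" "star C y = y"
    "mult C y y = diff C (one C) (mult C a a)"
    and comm: "\<And>z. \<lbrakk>z \<in> carrier C; mult C (mult C a a) z = mult C z (mult C a a)\<rbrakk> \<Longrightarrow> mult C y z = mult C z y"
    by blast
  have "mult C y a = mult C a y" using comm[of a] a by (simp add: C.mult_assoc)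
  then have fc: "mult D (f y) (f a) = mult D (f a) (f y)" using y a by (simp flip: hom_mult)
  have "add C (mult C y y) (mult C a a) = one C" using y a by simp
  then have "f (add C (mult C y y) (mult C a a)) = one D" by (simp add: hom_one)
  then have "add D (mult D (f y) (f y)) (mult D (f a) (f a)) = smult D (complex_of_real 1) (one D)"
    using y(1) a(1) by (simp add: hom_add hom_mult)
  then have "(cnorm D (f a))\<^sup>2 \<le> 1"
    using y a fc by (intro D.cnorm_le_of_sum_squares[of "f y" "f a"]) (simp_all flip: hom_star)
  then show ?thesis by (simp add: abs_square_le_1)
qed

lemma cnorm_hom_le_self_adjoint:
  assumes a: "a \<in> carrier C" "star C a = a"
  shows "cnorm D (f a) \<le> cnorm C a"
proof (cases "a = zero C")
  case False
  define r where "r = cnorm C a"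
  have r: "r > 0" using False a C.cnorm_nonneg[of a] C.cnorm_eq_0_iff[of a] by (simp add: r_def less_le)
  have "cnorm D (f (smult C (complex_of_real (1/r)) a)) \<le> 1"
    using a r by (intro cnorm_hom_le_1) (simp_all add: norm_divide flip: r_def)
  then show ?thesis using a r by (simp add: hom_smult norm_divide field_simps flip: r_def)
qed (simp add: hom_zero)

text \<open>The C*-identity on both sides reduces the claim to the self-adjoint element
  \<open>mult C (star C x) x\<close>.\<close>

lemma cnorm_hom_le:
  assumes x: "x \<in> carrier C"
  shows "cnorm D (f x) \<le> cnorm C x"
proof -
  have "(cnorm D (f x))\<^sup>2 = cnorm D (f (mult C (star C x) x))"
    using x by (simp add: hom_mult hom_star D.cnorm_star_mult)
  also have "\<dots> \<le> cnorm C (mult C (star C x) x)"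
    using x by (intro cnorm_hom_le_self_adjoint) simp_all
  also have "\<dots> = (cnorm C x)\<^sup>2" using x by (simp add: C.cnorm_star_mult)
  finally show ?thesis by (rule power2_le_imp_le) (use x in simp)
qed

text \<open>If \<open>\<parallel>f a\<parallel> < \<parallel>a\<parallel> = 1\<close>, choose \<open>d\<close> with \<open>\<parallel>f a\<parallel>\<^sup>2 < d < 1\<close> and put
  \<open>c = (a\<^sup>2 - d) / 2\<close> and \<open>m = \<bar>c\<bar>\<close>. Then \<open>(m + c) (m - c) = 0\<close>, and \<open>f (m - c)\<close> is
  not a zero divisor because it is close to a scalar. Injectivity gives \<open>m = - c\<close>, and
  with \<open>m = n\<^sup>2\<close> this reads \<open>n\<^sup>2 + a\<^sup>2 / 2 = d / 2\<close>, contradicting \<open>\<parallel>a\<parallel> = 1\<close>.\<close>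

lemma cnorm_hom_ge_1:
  assumes inj: "inj_on f (carrier C)"
    and a: "a \<in> carrier C" "star C a = a" "cnorm C a = 1"
  shows "1 \<le> cnorm D (f a)"
proof (rule ccontr)
  assume "\<not> 1 \<le> cnorm D (f a)"
  define e where "e = (cnorm D (f a))\<^sup>2"
  define d where "d = (1 + e) / 2"
  have "e < 1"
    using \<open>\<not> 1 \<le> cnorm D (f a)\<close> a(1) by (simp add: e_def power_less_one_iff abs_square_less_1)
  then have d: "e < d" "d < 1" "0 \<le> e" by (simp_all add: d_def e_def)
  define b where "b = mult C a a"
  have b: "b \<in> carrier C" "star C b = b" "cnorm C b = 1" "mult C b a = mult C a b"
    using a by (simp_all add: b_def C.cnorm_square C.mult_assoc)
  have fb: "cnorm D (f b) = e"
    using a D.cnorm_square[of "f a"] by (simp add: b_def hom_mult e_def flip: hom_star)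
  \<comment> \<open>Halving keeps ||c|| <= (1 + d) / 2 <= 1, as the square roots below
    demand.\<close>
  define c where "c = diff C (smult C (1/2) b) (smult C (complex_of_real (d/2)) (one C))"
  have c: "c \<in> carrier C" "star C c = c" using b by (simp_all add: c_def C.star_diff)
  have ca: "mult C c a = mult C a c"
    using a(1) b(1,4) by (simp add: c_def C.diff_mult C.mult_diff)
  have "cnorm C c \<le> 1/2 * cnorm C b + d/2 * cnorm C (one C)"
    unfolding c_def using b(1) d
      C.cnorm_diff_le[of "smult C (1/2) b" "smult C (complex_of_real (d/2)) (one C)"]
    by (simp add: norm_divide)
  also have "\<dots> \<le> 1/2 * 1 + d/2 * 1"
    using C.cnorm_one_le d b(3) by (intro add_mono mult_left_mono) simp_all
  finally have c_le: "cnorm C c \<le> 1" using d by simp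
  define cc where "cc = mult C c c"
  have cc: "cc \<in> carrier C" "star C cc = cc" "cnorm C cc \<le> 1"
    using c c_le by (simp_all add: cc_def C.cnorm_square power_le_one)
  \<comment> \<open>\<open>sqrt_exists\<close> produces roots of 1 - x, so the root m of c^2 is
    requested through x = 1 - c^2.\<close>
  define x where "x = diff C (one C) cc"
  have x: "x \<in> carrier C" "star C x = x" using cc by (simp_all add: x_def C.star_diff)
  have comm_x: "mult C x z = mult C z x" if "z \<in> carrier C" "mult C c z = mult C z c" for z
  proof -
    have "mult C cc z = mult C z cc" unfolding cc_def using c(1) that by (metis C.mult_assoc)
    then show ?thesis using cc(1) that(1) by (simp add: x_def C.diff_mult C.mult_diff)
  qed
  \<comment> \<open>The triangle inequality would only give 2. Instead, a root y of x satisfies c^2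
    + y^2 = 1, whence ||x|| = ||y||^2 <= 1.\<close>
  have x_le: "cnorm C x \<le> 1"
  proof -
    obtain y where y: "y \<in> carrier C" "star C y = y" "mult C y y = x"
      and comm: "\<And>z. \<lbrakk>z \<in> carrier C; mult C cc z = mult C z cc\<rbrakk> \<Longrightarrow> mult C y z = mult C z y"
      using C.sqrt_exists[OF cc(1,3,2)] unfolding x_def by metis
    have "mult C c y = mult C y c" using comm[of c] c(1) by (simp add: cc_def C.mult_assoc)
    then have "(cnorm C y)\<^sup>2 \<le> 1"
      using c y(1,2) cc(1)
      by (intro C.cnorm_le_of_sum_squares[of c y])
        (simp_all add: y(3) x_def flip: cc_def)
    then show ?thesis using y C.cnorm_square by auto
  qed
  obtain m where m: "m \<in> carrier C" "star C m = m" "mult C m m = diff C (one C) x"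
      "cnorm C (diff C (one C) m) \<le> 1"
    and m_comm: "\<And>z. \<lbrakk>z \<in> carrier C; mult C x z = mult C z x\<rbrakk> \<Longrightarrow> mult C m z = mult C z m"
    using C.sqrt_exists[OF x(1) x_le x(2)] by metis
  have mm: "mult C m m = cc" using cc(1) by (simp add: m(3) x_def C.ring_simps)
  have mc: "mult C m c = mult C c m" by (intro m_comm comm_x c refl)
  have ma: "mult C m a = mult C a m" by (intro m_comm comm_x a ca)
  \<comment> \<open>The norm clause for m says ||s|| <= 1, and m = 1 - s; this is what later yields
    the root n of m.\<close>
  define s where "s = diff C (one C) m"
  have s: "s \<in> carrier C" "star C s = s" "cnorm C s \<le> 1" "mult C s a = mult C a s"
    using m a(1) ma by (simp_all add: s_def C.star_diff C.diff_mult C.mult_diff)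
  define h where "h = add C m c"
  \<comment> \<open>Isolates the scalar in m - c = k - w. Contractivity on s and ||f b|| = e bound
    ||f w|| by 1 + e/2, which is less than k because e < d.\<close>
  define w where "w = add C s (smult C (1/2) b)"
  define k where "k = 1 + d/2"
  have h: "h \<in> carrier C" and w: "w \<in> carrier C" using m c s b by (simp_all add: h_def w_def)
  have "mult C h (diff C m c) = zero C"
    unfolding h_def using m(1) c(1) mc mm cc(1) by (simp add: C.ring_simps flip: cc_def)
  moreover have "diff C m c = diff C (smult C (complex_of_real k) (one C)) w"
    using m(1) b(1) C.add_smult[of "one C" 1 "d/2"]
    by (simp add: c_def w_def s_def k_def C.ring_simps)
  ultimately have "mult C h (diff C (smult C (complex_of_real k) (one C)) w) = zero C" by simp
  then have "diff C (smult C (complex_of_real k) h) (mult C h w) = zero C"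
    using h w by (simp add: C.mult_diff)
  then have "smult C (complex_of_real k) h = mult C h w"
    using h w by (simp add: C.diff_eq_iff)
  then have "smult D (complex_of_real k) (f h) = mult D (f h) (f w)"
    using h w by (metis hom_mult hom_smult)
  moreover have "cmod (complex_of_real k) = k" using d by (simp only: norm_of_real) (simp add: k_def)
  \<comment> \<open>A norm estimate takes the place of inverting k - f w: a nonzero f h would force
    k <= 1 + e/2.\<close>
  ultimately have "k * cnorm D (f h) \<le> cnorm D (f h) * cnorm D (f w)"
    using D.cnorm_mult_le[of "f h" "f w"] D.cnorm_smult[of "f h" "complex_of_real k"] h w
    by (simp only: hom_closed)
  also have "cnorm D (f w) \<le> 1 + e/2"
    using D.cnorm_add_le[of "f s" "smult D (1/2) (f b)"] cnorm_hom_le[OF s(1)] s b(1) fb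
    by (simp add: w_def hom_add hom_smult norm_divide)
  then have "cnorm D (f h) * cnorm D (f w) \<le> cnorm D (f h) * (1 + e/2)"
    using h by (intro mult_left_mono) simp_all
  finally have "cnorm D (f h) * (k - (1 + e/2)) \<le> 0" by (simp add: algebra_simps)
  moreover have "k - (1 + e/2) > 0" using d by (simp add: k_def)
  ultimately have "cnorm D (f h) \<le> 0" by (simp add: mult_le_0_iff)
  then have "f h = f (zero C)" using h D.cnorm_eq_0_iff[of "f h"] D.cnorm_nonneg[of "f h"]
    by (simp add: hom_zero order_antisym)
  then have "h = zero C" using inj h by (simp add: inj_on_eq_iff)
  then have "add C m (smult C (1/2) b) = smult C (complex_of_real (d/2)) (one C)"
    using m(1) b(1) by (simp add: h_def c_def C.ring_simps)
  moreover obtain n where n: "n \<in> carrier C" "star C n = n" "mult C n n = m"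
    and n_comm: "\<And>z. \<lbrakk>z \<in> carrier C; mult C s z = mult C z s\<rbrakk> \<Longrightarrow> mult C n z = mult C z n"
  proof -
    have "diff C (one C) s = m" using m(1) by (simp add: s_def C.ring_simps)
    then show thesis using C.sqrt_exists[OF s(1,3,2)] that by metis
  qed
  moreover have half: "(1 / complex_of_real (sqrt 2))\<^sup>2 = 1/2"
    by (simp add: power_divide flip: of_real_power)
  \<comment> \<open>The factor 1 / sqrt 2 makes v^2 = b/2, so that m + b/2 = d/2 becomes a sum of
    two squares.\<close>
  moreover define v where "v = smult C (complex_of_real (1 / sqrt 2)) a"
  ultimately have sum: "add C (mult C n n) (mult C v v) = smult C (complex_of_real (d/2)) (one C)"
    using a(1) by (simp add: b_def half flip: power2_eq_square)
  have "mult C n v = mult C v n" using n_comm[OF a(1) s(4)] a(1) n(1) by (simp add: v_def)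
  \<comment> \<open>Since ||v||^2 = ||a||^2 / 2 = 1/2, this contradicts d < 1.\<close>
  then have "(cnorm C v)\<^sup>2 \<le> d/2"
    using a n d by (intro C.cnorm_le_of_sum_squares[OF n(1,2) _ _ _ sum]) (simp_all add: v_def)
  then show False using a d by (simp add: v_def norm_divide power_divide)
qed

text \<open>The lower bound for norm one is applied to x* x divided by its norm; the C*-identity
  translates back to x.\<close>

lemma cnorm_hom:
  assumes inj: "inj_on f (carrier C)" and x: "x \<in> carrier C"
  shows "cnorm D (f x) = cnorm C x"
proof (cases "x = zero C")
  case False
  define y where "y = mult C (star C x) x"
  define r where "r = cnorm C y"
  have y: "y \<in> carrier C" "star C y = y" and r_eq: "r = (cnorm C x)\<^sup>2"
    using x by (simp_all add: y_def r_def C.cnorm_star_mult)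
  have r: "r > 0" using False x C.cnorm_eq_0_iff[of x] by (simp add: r_eq)
  have fy: "cnorm D (f y) = (cnorm D (f x))\<^sup>2"
    using x by (simp add: y_def hom_mult hom_star D.cnorm_star_mult)
  define a where "a = smult C (complex_of_real (1/r)) y"
  have "a \<in> carrier C" "star C a = a" using y by (simp_all add: a_def)
  moreover have "cnorm C a = 1" using y(1) r by (simp add: a_def norm_divide flip: r_def)
  ultimately have "1 \<le> cnorm D (f a)" by (rule cnorm_hom_ge_1[OF inj])
  also have "cnorm D (f a) = cnorm D (f y) / r"
    using y(1) r by (simp add: a_def hom_smult norm_divide)
  finally have "(cnorm C x)\<^sup>2 \<le> (cnorm D (f x))\<^sup>2"
    using r by (simp add: fy flip: r_eq)
  then have "cnorm C x \<le> cnorm D (f x)"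
    by (rule power2_le_imp_le) (use x in simp)
  then show ?thesis using cnorm_hom_le[OF x] by simp
qed (simp add: hom_zero)

text \<open>Isometry enters in the closedness: preimages of a convergent sequence are Cauchy,
  converge by completeness of C, and the image of their limit is the given limit.\<close>

lemma cstar_subalg_image:
  assumes inj: "inj_on f (carrier C)"
  shows "cstar_subalg D (f ` carrier C)"
proof -
  have closed: "y \<in> f ` carrier C"
    if g: "\<forall>n. g n \<in> f ` carrier C" and y: "y \<in> carrier D"
      and lim: "\<forall>e>0. \<exists>N. \<forall>n\<ge>N. cdist D (g n) y < e" for g :: "nat \<Rightarrow> 'b" and y
  proof -
    have "\<forall>n. \<exists>x. x \<in> carrier C \<and> g n = f x" using g by blast
    then obtain h where h: "\<And>n. h n \<in> carrier C" "\<And>n. g n = f (h n)" by metis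
    have iso: "cdist D (f u) (f v) = cdist C u v" if "u \<in> carrier C" "v \<in> carrier C" for u v
      using that cnorm_hom[OF inj, of "diff C u v"] by (simp add: C.cdist_eq D.cdist_eq hom_diff)
    have "\<exists>N. \<forall>m\<ge>N. \<forall>n\<ge>N. cdist C (h m) (h n) < e" if "e > 0" for e
    proof -
      obtain N where N: "\<forall>n\<ge>N. cdist D (g n) y < e/2" using lim \<open>e > 0\<close> half_gt_zero by blast
      have "cdist C (h m) (h n) < e" if "m \<ge> N" "n \<ge> N" for m n
      proof -
        have "cdist C (h m) (h n) \<le> cdist D (g m) y + cdist D (g n) y"
          using D.cdist_triangle[of "g m" y "g n"] D.cdist_commute[of y "g n"] h y by (simp add: iso)
        moreover have "cdist D (g m) y < e/2" "cdist D (g n) y < e/2" using N that by auto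
        ultimately show ?thesis by linarith
      qed
      then show ?thesis by blast
    qed
    from C.Cauchy_imp_limit[of h, OF h(1) this]
    obtain x where x: "x \<in> carrier C" "\<And>e. e > 0 \<Longrightarrow> \<exists>N. \<forall>n\<ge>N. cdist C (h n) x < e"
      by blast
    have "f x = y"
    proof (rule D.limit_unique[of g])
      show "(\<lambda>n. cdist D (g n) (f x)) \<longlonglongrightarrow> 0"
        using x h by (simp add: LIMSEQ_iff iso)
      show "(\<lambda>n. cdist D (g n) y) \<longlonglongrightarrow> 0"
        using lim y h by (simp add: LIMSEQ_iff)
    qed (use x y h in simp_all)
    then show ?thesis using x(1) by blast
  qed
  have "\<forall>x\<in>f ` carrier C. \<forall>y\<in>f ` carrier C. add D x y \<in> f ` carrier C \<and> mult D x y \<in> f ` carrier C"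
    "\<forall>a. \<forall>x\<in>f ` carrier C. smult D a x \<in> f ` carrier C" "\<forall>x\<in>f ` carrier C. star D x \<in> f ` carrier C"
    by (auto simp flip: hom_add hom_mult hom_smult hom_star)
  moreover have "one D \<in> f ` carrier C" by (metis C.one_closed hom_one imageI)
  moreover have "f ` carrier C \<subseteq> carrier D" by auto
  ultimately show ?thesis
    unfolding cstar_subalg_def by (intro conjI) (use closed in blast)+
qed

end

section \<open>C*-subalgebras as C*-algebras in their own right\<close>

lemma cstar_subalg_subset: "cstar_subalg C Y \<Longrightarrow> Y \<subseteq> carrier C"
  unfolding cstar_subalg_def by (elim conjE)

lemma cstar_subalg_limit:
  assumes "cstar_subalg C Y" "\<And>n. g n \<in> Y" "x \<in> carrier C"
    and "\<And>e. e > 0 \<Longrightarrow> \<exists>N::nat. \<forall>n\<ge>N. cdist C (g n) x < e"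
  shows "x \<in> Y"
proof -
  have "\<forall>f x. (\<forall>n. f n \<in> Y) \<and> x \<in> carrier C \<and> (\<forall>e>0. \<exists>N::nat. \<forall>n\<ge>N. cdist C (f n) x < e) \<longrightarrow> x \<in> Y"
    using assms(1) unfolding cstar_subalg_def by (elim conjE)
  with assms(2-) show ?thesis by blast
qed

lemma cstar_alg_sub_cstar:
  assumes "cstar_alg C" and Y: "cstar_subalg C Y"
  shows "cstar_alg (sub_cstar C Y)"
proof -
  interpret cstar_algebra C by (unfold_locales) fact
  have sub: "x \<in> carrier C" if "x \<in> Y" for x
    using cstar_subalg_subset[OF Y] that by blast
  have one: "one C \<in> Y"
    using Y unfolding cstar_subalg_def by (elim conjE)
  have closed: "\<forall>x\<in>Y. \<forall>y\<in>Y. add C x y \<in> Y \<and> mult C x y \<in> Y"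
    using Y unfolding cstar_subalg_def by (elim conjE)
  have star: "\<forall>x\<in>Y. star C x \<in> Y"
    using Y unfolding cstar_subalg_def by (elim conjE)
  have sm: "\<forall>a. \<forall>x\<in>Y. smult C a x \<in> Y"
    using Y unfolding cstar_subalg_def by (elim conjE)
  \<comment> \<open>\<open>cstar_subalg\<close> does not list the zero element; it is obtained as a
    multiple of the unit.\<close>
  have "smult C 0 (one C) \<in> Y" using sm one by blast
  then have zero: "zero C \<in> Y" by simp
  have complete: "\<exists>x\<in>Y. \<forall>e>0. \<exists>N. \<forall>n\<ge>N. cdist C (g n) x < e"
    if g: "\<forall>n. g n \<in> Y" "\<forall>e>0. \<exists>N::nat. \<forall>m\<ge>N. \<forall>n\<ge>N. cdist C (g m) (g n) < e" for g
  proof -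
    obtain x where "x \<in> carrier C" "\<And>e. e > 0 \<Longrightarrow> \<exists>N. \<forall>n\<ge>N. cdist C (g n) x < e"
    proof (rule Cauchy_imp_limit[of g])
      show "g n \<in> carrier C" for n using g(1) sub by blast
    qed (use g(2) in blast)+
    moreover from this have "x \<in> Y" using cstar_subalg_limit[OF Y, of g x] g(1) by blast
    ultimately show ?thesis by blast
  qed
  have cdist_sub: "cdist (sub_cstar C Y) = cdist C"
    by (intro ext) (simp add: cdist_def sub_cstar_def)
  have sel: "carrier (sub_cstar C Y) = Y" "zero (sub_cstar C Y) = zero C" "one (sub_cstar C Y) = one C"
    "add (sub_cstar C Y) = add C" "smult (sub_cstar C Y) = smult C" "mult (sub_cstar C Y) = mult C"
    "star (sub_cstar C Y) = star C" "cnorm (sub_cstar C Y) = cnorm C"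
    by (simp_all add: sub_cstar_def)
  show ?thesis
    unfolding cstar_alg_def Let_def cdist_sub sel
  proof (intro conjI allI ballI impI)
    show "add C x y = add C y x" if "x \<in> Y" "y \<in> Y" for x y
      using that sub by (intro add_commute)
    show "\<exists>x\<in>Y. \<forall>e>0. \<exists>N. \<forall>n\<ge>N. cdist C (g n) x < e"
      if "(\<forall>n. g n \<in> Y) \<and> (\<forall>e>0. \<exists>N::nat. \<forall>m\<ge>N. \<forall>n\<ge>N. cdist C (g m) (g n) < e)" for g
      using that complete by blast
  qed (simp_all add: sub zero one closed star sm add_assoc smult_add add_smult mult_assoc mult_add
      add_mult star_add cnorm_eq_0_iff cnorm_add_le cnorm_mult_le cnorm_star_mult)
qed

section \<open>Local algebras of a causal functor\<close>

lemma below_sel [simp]: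
  "cs_carrier (below K p) = {a \<in> cs_carrier K. cs_le K a p}"
  "cs_le (below K p) x y \<longleftrightarrow> x \<in> cs_carrier (below K p) \<and> y \<in> cs_carrier (below K p) \<and> cs_le K x y"
  "cs_perp (below K p) x y \<longleftrightarrow> x \<in> cs_carrier (below K p) \<and> y \<in> cs_carrier (below K p) \<and> cs_perp K x y"
  by (simp_all add: below_def Let_def)

lemma causal_poset_le_closed:
  assumes "causal_poset K" "cs_le K x y"
  shows "x \<in> cs_carrier K" "y \<in> cs_carrier K"
  using assms unfolding causal_poset_def poset_def by blast+

lemma causal_poset_refl: "\<lbrakk>causal_poset K; x \<in> cs_carrier K\<rbrakk> \<Longrightarrow> cs_le K x x"
  unfolding causal_poset_def poset_def by blast

lemma causal_poset_trans: "\<lbrakk>causal_poset K; cs_le K x y; cs_le K y z\<rbrakk> \<Longrightarrow> cs_le K x z"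
  unfolding causal_poset_def poset_def by blast

lemma causal_poset_antisym: "\<lbrakk>causal_poset K; cs_le K x y; cs_le K y x\<rbrakk> \<Longrightarrow> x = y"
  unfolding causal_poset_def poset_def by blast

lemma cmor_closed: "\<lbrakk>\<psi> \<in> cmor K K'; x \<in> cs_carrier K\<rbrakk> \<Longrightarrow> \<psi> x \<in> cs_carrier K'"
  unfolding cmor_def by blast

lemma cmor_le:
  "\<lbrakk>\<psi> \<in> cmor K K'; x \<in> cs_carrier K; y \<in> cs_carrier K; cs_le K x y\<rbrakk> \<Longrightarrow> cs_le K' (\<psi> x) (\<psi> y)"
  unfolding cmor_def by blast

text \<open>The point \<open>p\<close> is a greatest element of \<open>below K p\<close>, so the set
  is nonempty and any two of its points are joined by a single step through \<open>p\<close>. The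
  other axioms are inherited.\<close>

lemma causal_poset_below:
  assumes K: "causal_poset K" and p: "p \<in> cs_carrier K"
  shows "causal_poset (below K p)"
  unfolding causal_poset_def
proof (intro conjI)
  have pp: "cs_le K p p" by (rule causal_poset_refl[OF K p])
  then have "cs_carrier (below K p) \<noteq> {}" using p by auto
  moreover have "cs_le (below K p) x x" if "x \<in> cs_carrier (below K p)" for x
    using that causal_poset_refl[OF K, of x] by simp
  moreover have "x = y" if "cs_le (below K p) x y" "cs_le (below K p) y x" for x y
    using that causal_poset_antisym[OF K] by simp
  moreover have "cs_le (below K p) x z" if "cs_le (below K p) x y" "cs_le (below K p) y z" for x y z
    using that causal_poset_trans[OF K, of x y z] by simp
  ultimately show "poset (below K p)"
    unfolding poset_def by (simp only: below_sel(2)) blast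
  show "causal_disjointness (below K p)"
    unfolding causal_disjointness_def
  proof (intro conjI allI impI)
    have disj: "causal_disjointness K" using K by (simp add: causal_poset_def)
    fix x y z
    show "x \<in> cs_carrier (below K p)" "y \<in> cs_carrier (below K p)" if "cs_perp (below K p) x y"
      using that by simp_all
    show "\<not> cs_perp (below K p) x x"
      using disj unfolding causal_disjointness_def below_sel by blast
    show "cs_perp (below K p) y x" if "cs_perp (below K p) x y"
      using that disj unfolding causal_disjointness_def below_sel(3) by blast
    show "cs_perp (below K p) z y" if "cs_perp (below K p) x y \<and> cs_le (below K p) z x"
      using that disj unfolding causal_disjointness_def below_sel(2,3) by blast
  qed
  show "pathwise_connected (below K p)"
    unfolding pathwise_connected_def
  proof (intro ballI)
    fix a a' assume "a \<in> cs_carrier (below K p)" "a' \<in> cs_carrier (below K p)"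
    then show "\<exists>n::nat. \<exists>as os.
        (\<forall>i\<le>n. as i \<in> cs_carrier (below K p)) \<and> (\<forall>i<n. os i \<in> cs_carrier (below K p)) \<and>
        as 0 = a \<and> as n = a' \<and>
        (\<forall>i<n. cs_le (below K p) (as i) (os i) \<and> cs_le (below K p) (as (Suc i)) (os i))"
      using p pp
      by (intro exI[of _ 1] exI[of _ "\<lambda>i. if i = 0 then a else a'"] exI[of _ "\<lambda>_. p"]) auto
  qed
qed

text \<open>Morphisms in \<open>cmor\<close> are extensional, hence the \<open>restrict\<close>. It
  supplies the morphism between the lower sets through which the local algebras are
  compared.\<close>

lemma restrict_cmor_below:
  assumes \<psi>: "\<psi> \<in> cmor K K'"
    and le: "\<And>x. cs_le K x p \<Longrightarrow> x \<in> cs_carrier K \<Longrightarrow> cs_le K' (\<psi> x) q"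
  shows "restrict \<psi> (cs_carrier (below K p)) \<in> cmor (below K p) (below K' q)"
  using \<psi> le unfolding cmor_def by (auto simp: inj_on_def image_subset_iff)

lemma cid_cmor: "cid K \<in> cmor K K"
  by (auto simp: cmor_def cid_def inj_on_def)

lemma incl_cmor:
  "incl K p \<in> cmor (below K p) K"
  unfolding incl_def cmor_def by (auto simp: inj_on_def)

lemma incl_le: "a \<in> cs_carrier (below K p) \<Longrightarrow> cs_le K (incl K p a) p"
  by (simp add: incl_def)

section \<open>The functor laws\<close>

locale cstar_functor =
  fixes Aobj :: "'a causet \<Rightarrow> 'b cstar"
    and Amor :: "'a causet \<Rightarrow> 'a causet \<Rightarrow> ('a \<Rightarrow> 'a) \<Rightarrow> 'b \<Rightarrow> 'b"
  assumes F: "cstar_causal_functor Aobj Amor"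
begin

lemma Aobj_cstar_alg: "causal_poset K \<Longrightarrow> cstar_alg (Aobj K)"
  using F unfolding cstar_causal_functor_def by (elim conjE) blast

lemma Amor_arrow:
  "\<lbrakk>causal_poset K; causal_poset K'; \<psi> \<in> cmor K K'\<rbrakk> \<Longrightarrow> cstar_arrow (Aobj K) (Aobj K') (Amor K K' \<psi>)"
  using F unfolding cstar_causal_functor_def by (elim conjE) blast

lemma Amor_cid: "\<lbrakk>causal_poset K; x \<in> carrier (Aobj K)\<rbrakk> \<Longrightarrow> Amor K K (cid K) x = x"
  using F unfolding cstar_causal_functor_def by (elim conjE) blast

lemma Amor_compose:
  assumes "causal_poset K1" "causal_poset K2" "causal_poset K3"
    and "\<psi> \<in> cmor K1 K2" "\<phi> \<in> cmor K2 K3" "x \<in> carrier (Aobj K1)"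
  shows "Amor K1 K3 (compose (cs_carrier K1) \<phi> \<psi>) x = Amor K2 K3 \<phi> (Amor K1 K2 \<psi> x)"
proof -
  have "\<forall>K1 K2 K3 \<psi> \<phi>. causal_poset K1 \<and> causal_poset K2 \<and> causal_poset K3
        \<and> \<psi> \<in> cmor K1 K2 \<and> \<phi> \<in> cmor K2 K3 \<longrightarrow>
        (\<forall>x\<in>carrier (Aobj K1).
           Amor K1 K3 (compose (cs_carrier K1) \<phi> \<psi>) x = Amor K2 K3 \<phi> (Amor K1 K2 \<psi> x))"
    using F unfolding cstar_causal_functor_def by (elim conjE)
  then show ?thesis using assms by blast
qed

lemma Amor_commute:
  assumes "causal_poset K1" "causal_poset K2" "causal_poset K"
    and "\<psi>1 \<in> cmor K1 K" "\<psi>2 \<in> cmor K2 K" "p \<in> cs_carrier K" "q \<in> cs_carrier K" "cs_perp K p q"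
    and "\<And>a. a \<in> cs_carrier K1 \<Longrightarrow> cs_le K (\<psi>1 a) p" "\<And>a. a \<in> cs_carrier K2 \<Longrightarrow> cs_le K (\<psi>2 a) q"
    and "x \<in> carrier (Aobj K1)" "y \<in> carrier (Aobj K2)"
  shows "mult (Aobj K) (Amor K1 K \<psi>1 x) (Amor K2 K \<psi>2 y) = mult (Aobj K) (Amor K2 K \<psi>2 y) (Amor K1 K \<psi>1 x)"
proof -
  have "\<forall>K1 K2 K \<psi>1 \<psi>2 o1 o2. causal_poset K1 \<and> causal_poset K2 \<and> causal_poset K
        \<and> \<psi>1 \<in> cmor K1 K \<and> \<psi>2 \<in> cmor K2 K
        \<and> o1 \<in> cs_carrier K \<and> o2 \<in> cs_carrier K \<and> cs_perp K o1 o2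
        \<and> (\<forall>a\<in>cs_carrier K1. cs_le K (\<psi>1 a) o1)
        \<and> (\<forall>a\<in>cs_carrier K2. cs_le K (\<psi>2 a) o2) \<longrightarrow>
        (\<forall>A\<in>carrier (Aobj K1). \<forall>B\<in>carrier (Aobj K2).
           mult (Aobj K) (Amor K1 K \<psi>1 A) (Amor K2 K \<psi>2 B)
         = mult (Aobj K) (Amor K2 K \<psi>2 B) (Amor K1 K \<psi>1 A))"
    using F unfolding cstar_causal_functor_def by (elim conjE)
  from this[rule_format, of K1 K2 K \<psi>1 \<psi>2 p q x y] show ?thesis using assms by blast
qed

lemma Amor_closed:
  assumes "causal_poset K" "causal_poset K'" "\<psi> \<in> cmor K K'" "x \<in> carrier (Aobj K)"
  shows "Amor K K' \<psi> x \<in> carrier (Aobj K')"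
  using Amor_arrow[OF assms(1-3)] assms(4) unfolding cstar_arrow_def star_hom_def by blast

section \<open>Closedness, isotony, causality and covariance of the local algebras\<close>

lemma local_alg_cstar_subalg:
  assumes K: "causal_poset K" and p: "p \<in> cs_carrier K"
  shows "cstar_subalg (Aobj K) (local_alg Aobj Amor K p)"
proof -
  have cp: "causal_poset (below K p)" by (rule causal_poset_below[OF K p])
  have arrow: "cstar_arrow (Aobj (below K p)) (Aobj K) (Amor (below K p) K (incl K p))"
    by (rule Amor_arrow[OF cp K incl_cmor])
  interpret cstar_hom "Aobj (below K p)" "Aobj K" "Amor (below K p) K (incl K p)"
    using arrow Aobj_cstar_alg[OF cp] Aobj_cstar_alg[OF K] by unfold_locales (simp_all add: cstar_arrow_def)
  show ?thesis
    unfolding local_alg_def using arrow by (intro cstar_subalg_image) (simp add: cstar_arrow_def)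
qed

text \<open>Covers both isotony (\<open>\<psi>\<close> the identity) and covariance (\<open>\<psi>\<close> a symmetry).\<close>

lemma Amor_local_alg_subset:
  assumes K: "causal_poset K" and p: "p \<in> cs_carrier K" and q: "q \<in> cs_carrier K"
    and \<psi>: "\<psi> \<in> cmor K K" and le: "cs_le K (\<psi> p) q"
  shows "Amor K K \<psi> ` local_alg Aobj Amor K p \<subseteq> local_alg Aobj Amor K q"
proof
  fix z assume "z \<in> Amor K K \<psi> ` local_alg Aobj Amor K p"
  then obtain x where x: "x \<in> carrier (Aobj (below K p))"
    and z: "z = Amor K K \<psi> (Amor (below K p) K (incl K p) x)"
    unfolding local_alg_def by blast
  let ?\<rho> = "restrict \<psi> (cs_carrier (below K p))"
  have cp: "causal_poset (below K p)" and cq: "causal_poset (below K q)"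
    using causal_poset_below[OF K p] causal_poset_below[OF K q] .
  have \<rho>: "?\<rho> \<in> cmor (below K p) (below K q)"
  proof (rule restrict_cmor_below[OF \<psi>])
    fix y assume "cs_le K y p" "y \<in> cs_carrier K"
    then have "cs_le K (\<psi> y) (\<psi> p)" using cmor_le[OF \<psi> _ p] by blast
    then show "cs_le K (\<psi> y) q" using le by (rule causal_poset_trans[OF K])
  qed
  \<comment> \<open>An equality of total functions is required: the composites agree below
    \<open>p\<close>, and \<open>compose\<close> makes both undefined elsewhere.\<close>
  have "compose (cs_carrier (below K p)) \<psi> (incl K p) = compose (cs_carrier (below K p)) (incl K q) ?\<rho>"
    (is "?l = ?r")
  proof
    fix y show "?l y = ?r y"
    proof (cases "y \<in> cs_carrier (below K p)")
      case True
      then have "?\<rho> y \<in> cs_carrier (below K q)" by (rule cmor_closed[OF \<rho>])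
      then show ?thesis using True by (simp add: compose_def incl_def)
    qed (auto simp: compose_def)
  qed
  then have "z = Amor (below K q) K (incl K q) (Amor (below K p) (below K q) ?\<rho> x)"
    using Amor_compose[OF cp K K incl_cmor \<psi> x] Amor_compose[OF cp cq K \<rho> incl_cmor x] z by simp
  then show "z \<in> local_alg Aobj Amor K q"
    unfolding local_alg_def using Amor_closed[OF cp cq \<rho> x] by blast
qed

lemma local_alg_mono:
  assumes K: "causal_poset K" and le: "cs_le K p q"
  shows "local_alg Aobj Amor K p \<subseteq> local_alg Aobj Amor K q"
proof -
  have p: "p \<in> cs_carrier K" and q: "q \<in> cs_carrier K"
    using causal_poset_le_closed[OF K le] .
  have "Amor K K (cid K) ` local_alg Aobj Amor K p \<subseteq> local_alg Aobj Amor K q"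
    using le p by (intro Amor_local_alg_subset K p q cid_cmor) (simp add: cid_def)
  \<comment> \<open>The identity law speaks only of the carrier of \<open>Aobj K\<close>, so the
    local algebra must first be known to lie in it.\<close>
  moreover have "Amor K K (cid K) x = x" if "x \<in> local_alg Aobj Amor K p" for x
    using cstar_subalg_subset[OF local_alg_cstar_subalg[OF K p]] that Amor_cid[OF K] by blast
  ultimately show ?thesis by (auto simp: image_subset_iff)
qed

lemma local_cnet:
  assumes K: "causal_poset K"
  shows "cnet K (\<lambda>p. sub_cstar (Aobj K) (local_alg Aobj Amor K p)) (\<lambda>a p. id)"
  unfolding cnet_def
proof (intro conjI ballI allI impI)
  show "cstar_alg (sub_cstar (Aobj K) (local_alg Aobj Amor K p))" if "p \<in> cs_carrier K" for p
    using that K by (intro cstar_alg_sub_cstar Aobj_cstar_alg local_alg_cstar_subalg)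
  show "cstar_arrow (sub_cstar (Aobj K) (local_alg Aobj Amor K p))
      (sub_cstar (Aobj K) (local_alg Aobj Amor K a)) id" if "cs_le K p a" for p a
    using local_alg_mono[OF K that] by (simp add: cstar_arrow_def star_hom_def sub_cstar_def)
qed simp

text \<open>The connecting maps are \<open>id\<close> and \<open>sub_cstar\<close> keeps the
  product, so commutation over \<open>a\<close> is commutation in \<open>Aobj K\<close>. There the
  causality of the functor applies to the two inclusions, with \<open>o1\<close> and
  \<open>o2\<close> themselves as bounds.\<close>

lemma local_causal_net:
  assumes K: "causal_poset K"
  shows "causal_net K (\<lambda>p. sub_cstar (Aobj K) (local_alg Aobj Amor K p)) (\<lambda>a p. id)"
  unfolding causal_net_def
proof (intro conjI allI impI ballI local_cnet K; elim conjE)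
  fix a o1 o2 x y
  assume le: "cs_le K o1 a" "cs_le K o2 a" and perp: "cs_perp K o1 o2"
    and "x \<in> carrier (sub_cstar (Aobj K) (local_alg Aobj Amor K o1))"
    and "y \<in> carrier (sub_cstar (Aobj K) (local_alg Aobj Amor K o2))"
  then obtain u v where u: "u \<in> carrier (Aobj (below K o1))" "x = Amor (below K o1) K (incl K o1) u"
    and v: "v \<in> carrier (Aobj (below K o2))" "y = Amor (below K o2) K (incl K o2) v"
    by (auto simp: sub_cstar_def local_alg_def)
  have o12: "o1 \<in> cs_carrier K" "o2 \<in> cs_carrier K"
    using causal_poset_le_closed(1)[OF K] le by blast+
  have "mult (Aobj K) x y = mult (Aobj K) y x"
    unfolding u(2) v(2)
    by (rule Amor_commute[where p = o1 and q = o2]) (fact causal_poset_below[OF K o12(1)]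
      causal_poset_below[OF K o12(2)] K incl_cmor o12 perp incl_le u(1) v(1))+
  then show "mult (sub_cstar (Aobj K) (local_alg Aobj Amor K a)) (id x) (id y) =
      mult (sub_cstar (Aobj K) (local_alg Aobj Amor K a)) (id y) (id x)"
    by (simp add: sub_cstar_def)
qed

text \<open>The group inverse h of g provides the inverse map. Surjectivity onto the algebra of
  \<open>g p\<close> holds because h carries that algebra back into the one of
  \<open>h (g p) = p\<close>.\<close>

lemma symmetry_star_iso:
  assumes K: "causal_poset K" and S: "symmetry_group K S" and g: "g \<in> S"
  shows "star_automorphism (Aobj K) (Amor K K g)"
    and "p \<in> cs_carrier K \<Longrightarrow> star_iso (sub_cstar (Aobj K) (local_alg Aobj Amor K p))
        (sub_cstar (Aobj K) (local_alg Aobj Amor K (g p))) (Amor K K g)"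
proof -
  obtain h where h: "h \<in> S" "compose (cs_carrier K) g h = cid K" "compose (cs_carrier K) h g = cid K"
    using S g unfolding symmetry_group_def by blast
  have cmor: "g \<in> cmor K K" "h \<in> cmor K K"
    using S g h(1) unfolding symmetry_group_def automorphisms_def by blast+
  have gh: "Amor K K g (Amor K K h x) = x" and hg: "Amor K K h (Amor K K g x) = x"
    if "x \<in> carrier (Aobj K)" for x
    using Amor_compose[OF K K K cmor(2,1) that] Amor_compose[OF K K K cmor that] h(2,3)
      Amor_cid[OF K that] by simp_all
  have arrow: "star_hom (Aobj K) (Aobj K) (Amor K K g)"
    using Amor_arrow[OF K K cmor(1)] by (simp add: cstar_arrow_def)
  have "bij_betw (Amor K K g) (carrier (Aobj K)) (carrier (Aobj K))"
    by (rule bij_betw_byWitness[where f' = "Amor K K h"])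
      (use gh hg Amor_closed[OF K K] cmor in auto)
  with arrow show "star_automorphism (Aobj K) (Amor K K g)"
    by (simp add: star_automorphism_def star_iso_def)
  assume p: "p \<in> cs_carrier K"
  have gp: "g p \<in> cs_carrier K" by (rule cmor_closed[OF cmor(1) p])
  have hgp: "h (g p) = p" using fun_cong[OF h(3), of p] p by (simp add: compose_def cid_def)
  have sub: "Amor K K g ` local_alg Aobj Amor K p \<subseteq> local_alg Aobj Amor K (g p)"
    by (intro Amor_local_alg_subset K p gp cmor causal_poset_refl)
  have sub': "Amor K K h ` local_alg Aobj Amor K (g p) \<subseteq> local_alg Aobj Amor K p"
    by (intro Amor_local_alg_subset K p gp cmor) (simp add: hgp causal_poset_refl K p)
  have carr: "x \<in> carrier (Aobj K)" if "x \<in> local_alg Aobj Amor K q" "q \<in> cs_carrier K" for x q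
    using cstar_subalg_subset[OF local_alg_cstar_subalg[OF K that(2)]] that(1) by blast
  have "bij_betw (Amor K K g) (local_alg Aobj Amor K p) (local_alg Aobj Amor K (g p))"
    by (rule bij_betw_byWitness[where f' = "Amor K K h"])
      (use gh hg carr p gp sub sub' in auto)
  moreover have "star_hom (sub_cstar (Aobj K) (local_alg Aobj Amor K p))
      (sub_cstar (Aobj K) (local_alg Aobj Amor K (g p))) (Amor K K g)"
    using arrow sub carr[OF _ p] unfolding star_hom_def sub_cstar_def by simp
  ultimately show "star_iso (sub_cstar (Aobj K) (local_alg Aobj Amor K p))
        (sub_cstar (Aobj K) (local_alg Aobj Amor K (g p))) (Amor K K g)"
    by (simp add: star_iso_def sub_cstar_def)
qed

text \<open>The action at \<open>p\<close> is the one map \<open>Amor K K s\<close> for every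
  \<open>p\<close>, so it trivially respects the inclusions, and its composition law is
  functoriality.\<close>

lemma local_covariant_net:
  assumes K: "causal_poset K" and S: "symmetry_group K S"
  shows "covariant_net K S (\<lambda>p. sub_cstar (Aobj K) (local_alg Aobj Amor K p)) (\<lambda>a p. id)
    (\<lambda>s p. Amor K K s)"
  unfolding covariant_net_def
proof (intro conjI ballI allI impI local_cnet K symmetry_star_iso(2)[OF K S])
  fix g h p x
  assume gh: "g \<in> S" "h \<in> S" and p: "p \<in> cs_carrier K"
    and "x \<in> carrier (sub_cstar (Aobj K) (local_alg Aobj Amor K p))"
  then have x: "x \<in> carrier (Aobj K)"
    using cstar_subalg_subset[OF local_alg_cstar_subalg[OF K p]] unfolding sub_cstar_def by auto
  have "g \<in> cmor K K" "h \<in> cmor K K"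
    using S gh unfolding symmetry_group_def automorphisms_def by blast+
  then show "Amor K K g (Amor K K h x) = Amor K K (compose (cs_carrier K) g h) x"
    by (intro Amor_compose[symmetric] K x)
qed simp_all

end

theorem theorem2p5:
  fixes Aobj :: "'a causet \<Rightarrow> 'b cstar"
    and Amor :: "'a causet \<Rightarrow> 'a causet \<Rightarrow> ('a \<Rightarrow> 'a) \<Rightarrow> 'b \<Rightarrow> 'b"
    and K :: "'a causet"
  assumes F: "cstar_causal_functor Aobj Amor"
    and K: "causal_poset K"
  shows "(\<forall>p\<in>cs_carrier K. causal_poset (below K p) \<and> incl K p \<in> cmor (below K p) K)
       \<and> (\<forall>p\<in>cs_carrier K. cstar_subalg (Aobj K) (local_alg Aobj Amor K p))
       \<and> (\<forall>p a. cs_le K p a \<longrightarrow> local_alg Aobj Amor K p \<subseteq> local_alg Aobj Amor K a)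
       \<and> causal_net K (\<lambda>p. sub_cstar (Aobj K) (local_alg Aobj Amor K p)) (\<lambda>a p. id)
       \<and> (\<forall>S. symmetry_group K S \<longrightarrow>
            (\<forall>s\<in>S. star_automorphism (Aobj K) (Amor K K s)
               \<and> (\<forall>p\<in>cs_carrier K.
                    star_iso (sub_cstar (Aobj K) (local_alg Aobj Amor K p))
                             (sub_cstar (Aobj K) (local_alg Aobj Amor K (s p)))
                             (Amor K K s)))
            \<and> covariant_net K S (\<lambda>p. sub_cstar (Aobj K) (local_alg Aobj Amor K p)) (\<lambda>a p. id)
                 (\<lambda>s p. Amor K K s))"
proof -
  interpret cstar_functor Aobj Amor by (rule cstar_functor.intro[OF F])
  have "\<forall>p\<in>cs_carrier K. causal_poset (below K p) \<and> incl K p \<in> cmor (below K p) K"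
    using causal_poset_below[OF K] incl_cmor by (intro ballI conjI)
  moreover have "\<forall>p\<in>cs_carrier K. cstar_subalg (Aobj K) (local_alg Aobj Amor K p)"
    using local_alg_cstar_subalg[OF K] by (intro ballI)
  moreover have "\<forall>p a. cs_le K p a \<longrightarrow> local_alg Aobj Amor K p \<subseteq> local_alg Aobj Amor K a"
    using local_alg_mono[OF K] by (intro allI impI)
  moreover have "(\<forall>s\<in>S. star_automorphism (Aobj K) (Amor K K s)
      \<and> (\<forall>p\<in>cs_carrier K. star_iso (sub_cstar (Aobj K) (local_alg Aobj Amor K p))
            (sub_cstar (Aobj K) (local_alg Aobj Amor K (s p))) (Amor K K s)))
      \<and> covariant_net K S (\<lambda>p. sub_cstar (Aobj K) (local_alg Aobj Amor K p)) (\<lambda>a p. id)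
          (\<lambda>s p. Amor K K s)" if "symmetry_group K S" for S
    using symmetry_star_iso[OF K that] local_covariant_net[OF K that] by (intro conjI ballI)
  ultimately show ?thesis using local_causal_net[OF K] by simp
qed

end
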